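(* The vc-density of the theory of a one-based group has linear growth, provided that the group has finite dp-rank. Namely, if $G$ is a one-based group of finite dp-rank, then for every positive integer $m$ $$\mathrm{vc}^{\mathrm{Th}(G)}(m)=m\cdot\mathrm{vc}^{\mathrm{Th}(G)}(1).$$
   Context: Work in a complete theory with infinite models, inside a sufficiently saturated model. A group $G$ (possibly with additional structure) is one-based if for every $m$ any definable subset of $G^m$ is a finite boolean combination of cosets of $\mathrm{acl}^{\mathrm{eq}}(\emptyset)$-definable subgroups of $G^m$. The theory of a one-based group is stable. dp-rank. An inp-pattern of depth $\kappa$ for a partial type $\pi(x)$ is a sequence of formulas $(\varphi^\alpha(x,y^\alpha))_{\alpha<\kappa}$ together with natural numbers $(k^\alpha)_{\alpha<\kappa}$ such that there is an array of tuples $(b_i^\alpha)_{\alpha<\kappa,i<\omega}$ for which each row $\{\varphi^\alpha(x,b_i^\alpha)\}_{i<\omega}$ is $k^\alpha$-inconsistent, while for every $\eta:\kappa\to\omega$ the path $\pi(x)\cup\{\varphi^\alpha(x,b^\alpha_{\eta(\alpha)})\}_{\alpha<\kappa}$ is consistent. In a stable theory the dp-rank of $\pi$ is the supremum of the cardinals $\kappa$ for which there is an inp-pattern of depth $\kappa$ for $\pi$. The dp-rank of $G$ is the dp-rank of $\{x=x\}$ with $x$ a single variable. vc-density. For a class $\mathcal S$ of subsets of a set $X$, the shatter function is $\pi_{\mathcal S}(n)=\max\{|\{C\cap A:C\in\mathcal S\}|: A\subseteq X,|A|=n\}$, and $\mathrm{vc}(\mathcal S)$ is the infimum of the reals $r\ge0$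 with $\pi_{\mathcal S}(n)=O(n^r)$ ($\infty$ if there is none). For a formula $\varphi(x;y)$ with object variables $x$ and parameter variables $y$, $\mathcal S_\varphi=\{\varphi(\mathbb M;b):b\in\mathbb M^{|y|}\}$ for $\mathbb M$ a sufficiently saturated model of $T$. The vc-density of $T$ is the function $\mathrm{vc}^T(n)=\sup\{\mathrm{vc}(\mathcal S_\varphi):\varphi(x;y)\text{ a formula of }T\text{ with }|y|=n\}$. *)

theory Defs
  imports
    "HOL-Algebra.Product_Groups"
    "HOL-Library.Extended_Real"
    "HOL-Library.Landau_Symbols"
begin

unbundle cardinal_syntax

section \<open>First-order logic\<close>

record ('f, 'r) lang =
  fsyms :: "'f set"
  farity :: "'f \<Rightarrow> nat"
  rsyms :: "'r set"
  rarity :: "'r \<Rightarrow> nat"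

datatype 'f trm = Var nat | App 'f "'f trm list"

datatype ('f, 'r) fm =
    Eq "'f trm" "'f trm"
  | Rel 'r "'f trm list"
  | Neg "('f, 'r) fm"
  | Conj "('f, 'r) fm" "('f, 'r) fm"
  | Ex nat "('f, 'r) fm"

primrec wf_trm :: "('f, 'r) lang \<Rightarrow> 'f trm \<Rightarrow> bool" where
  "wf_trm L (Var i) \<longleftrightarrow> True"
| "wf_trm L (App f ts) \<longleftrightarrow>
     f \<in> fsyms L \<and> length ts = farity L f \<and> list_all (wf_trm L) ts"

primrec wf_fm :: "('f, 'r) lang \<Rightarrow> ('f, 'r) fm \<Rightarrow> bool" where
  "wf_fm L (Eq s t) \<longleftrightarrow> wf_trm L s \<and> wf_trm L t"
| "wf_fm L (Rel r ts) \<longleftrightarrow>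
     r \<in> rsyms L \<and> length ts = rarity L r \<and> list_all (wf_trm L) ts"
| "wf_fm L (Neg \<phi>) \<longleftrightarrow> wf_fm L \<phi>"
| "wf_fm L (Conj \<phi> \<psi>) \<longleftrightarrow> wf_fm L \<phi> \<and> wf_fm L \<psi>"
| "wf_fm L (Ex i \<phi>) \<longleftrightarrow> wf_fm L \<phi>"

definition formulas :: "('f, 'r) lang \<Rightarrow> ('f, 'r) fm set" where
  "formulas L = {\<phi>. wf_fm L \<phi>}"

primrec fv_trm :: "'f trm \<Rightarrow> nat set" where
  "fv_trm (Var i) = {i}"
| "fv_trm (App f ts) = \<Union> (set (map fv_trm ts))"

primrec fv :: "('f, 'r) fm \<Rightarrow> nat set" where
  "fv (Eq s t) = fv_trm s \<union> fv_trm t"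
| "fv (Rel r ts) = \<Union> (set (map fv_trm ts))"
| "fv (Neg \<phi>) = fv \<phi>"
| "fv (Conj \<phi> \<psi>) = fv \<phi> \<union> fv \<psi>"
| "fv (Ex i \<phi>) = fv \<phi> - {i}"

text \<open>The universe of a structure is the whole type \<open>'a\<close>. Interpretations are used only on
  symbols of the language and on argument lists of the right length.\<close>

record ('a, 'f, 'r) struct =
  fint :: "'f \<Rightarrow> 'a list \<Rightarrow> 'a"
  rint :: "'r \<Rightarrow> 'a list \<Rightarrow> bool"

primrec val :: "('a, 'f, 'r) struct \<Rightarrow> (nat \<Rightarrow> 'a) \<Rightarrow> 'f trm \<Rightarrow> 'a" where
  "val M e (Var i) = e i"
| "val M e (App f ts) = fint M f (map (val M e) ts)"

primrec sat :: "('a, 'f, 'r) struct \<Rightarrow> (nat \<Rightarrow> 'a) \<Rightarrow> ('f, 'r) fm \<Rightarrow> bool" where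
  "sat M e (Eq s t) \<longleftrightarrow> val M e s = val M e t"
| "sat M e (Rel r ts) \<longleftrightarrow> rint M r (map (val M e) ts)"
| "sat M e (Neg \<phi>) \<longleftrightarrow> \<not> sat M e \<phi>"
| "sat M e (Conj \<phi> \<psi>) \<longleftrightarrow> sat M e \<phi> \<and> sat M e \<psi>"
| "sat M e (Ex i \<phi>) \<longleftrightarrow> (\<exists>a. sat M (e(i := a)) \<phi>)"

definition Th :: "('f, 'r) lang \<Rightarrow> ('a, 'f, 'r) struct \<Rightarrow> ('f, 'r) fm set" where
  "Th L M = {\<phi> \<in> formulas L. fv \<phi> = {} \<and> (\<forall>e. sat M e \<phi>)}"

definition is_model :: "('a, 'f, 'r) struct \<Rightarrow> ('f, 'r) fm set \<Rightarrow> bool" where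
  "is_model M T \<longleftrightarrow> (\<forall>\<phi>\<in>T. \<forall>e. sat M e \<phi>)"

text \<open>An \<open>m\<close>-tuple is an extensional function on \<open>{..<m}\<close>, so that the \<open>m\<close>-th power of a group
  is the library's \<^const>\<open>product_group\<close> over \<open>{..<m}\<close>.\<close>

abbreviation tuples :: "nat \<Rightarrow> (nat \<Rightarrow> 'a) set" where
  "tuples m \<equiv> {..<m} \<rightarrow>\<^sub>E UNIV"

definition join :: "nat \<Rightarrow> (nat \<Rightarrow> 'a) \<Rightarrow> (nat \<Rightarrow> 'a) \<Rightarrow> nat \<Rightarrow> 'a" where
  "join m a b = (\<lambda>i. if i < m then a i else b (i - m))"

definition definable_over ::
  "('f, 'r) lang \<Rightarrow> ('a, 'f, 'r) struct \<Rightarrow> 'a set \<Rightarrow> nat \<Rightarrow> (nat \<Rightarrow> 'a) set \<Rightarrow> bool" where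
  "definable_over L M A m X \<longleftrightarrow>
     (\<exists>\<phi>\<in>formulas L. \<exists>e. (\<forall>i\<in>fv \<phi>. i < m \<or> e i \<in> A) \<and>
        X = {x \<in> tuples m. sat M (\<lambda>i. if i < m then x i else e i) \<phi>})"


section \<open>Partial types in one variable, and saturation\<close>

text \<open>A formula with parameters in a single object variable is a pair of a formula and a
  valuation: variable \<open>0\<close> is the object variable and the valuation supplies the parameters for
  the other free variables (its value at \<open>0\<close> is overwritten).\<close>

type_synonym ('a, 'f, 'r) pfm = "('f, 'r) fm \<times> (nat \<Rightarrow> 'a)"

definition holds :: "('a, 'f, 'r) struct \<Rightarrow> ('a, 'f, 'r) pfm \<Rightarrow> 'a \<Rightarrow> bool" where
  "holds M p a \<longleftrightarrow> sat M ((snd p)(0 := a)) (fst p)"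

definition pfms_over :: "('f, 'r) lang \<Rightarrow> 'a set \<Rightarrow> ('a, 'f, 'r) pfm set" where
  "pfms_over L A = {(\<phi>, e). \<phi> \<in> formulas L \<and> (\<forall>i\<in>fv \<phi> - {0}. e i \<in> A)}"

text \<open>Consistency with the elementary diagram of \<open>M\<close>, i.e. finite satisfiability in \<open>M\<close>.\<close>

definition consistent :: "('a, 'f, 'r) struct \<Rightarrow> ('a, 'f, 'r) pfm set \<Rightarrow> bool" where
  "consistent M \<pi> \<longleftrightarrow> (\<forall>q. q \<subseteq> \<pi> \<and> finite q \<longrightarrow> (\<exists>a. \<forall>p\<in>q. holds M p a))"

text \<open>\<open>M\<close> is \<open>\<kappa>\<^sup>+\<close>-saturated for \<open>\<kappa> = |L| + \<aleph>\<^sub>0\<close>, which is the number of formulas of \<open>L\<close>.\<close>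

definition sufficiently_saturated :: "('f, 'r) lang \<Rightarrow> ('a, 'f, 'r) struct \<Rightarrow> bool" where
  "sufficiently_saturated L M \<longleftrightarrow>
     (\<forall>A p. |A| \<le>o |formulas L| \<and> p \<subseteq> pfms_over L A \<and> consistent M p \<longrightarrow>
        (\<exists>a. \<forall>q\<in>p. holds M q a))"


section \<open>Imaginaries\<close>

text \<open>\<open>M\<^sup>e\<^sup>q\<close> has the home sort and a sort \<open>Imag n E\<close> for every formula \<open>E\<close> without parameters
  defining an equivalence relation on \<open>n\<close>-tuples; the elements of the latter are the classes.\<close>

datatype ('f, 'r) eqsort = Home | Imag nat "('f, 'r) fm"

datatype 'a eqelem = Pt (pt: 'a) | Cls "(nat \<Rightarrow> 'a) set"

definition imag_rel ::
  "('a, 'f, 'r) struct \<Rightarrow> nat \<Rightarrow> ('f, 'r) fm \<Rightarrow> ((nat \<Rightarrow> 'a) \<times> (nat \<Rightarrow> 'a)) set" where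
  "imag_rel M n E = {(a, b). a \<in> tuples n \<and> b \<in> tuples n \<and> sat M (join n a b) E}"

fun valid_sort :: "('f, 'r) lang \<Rightarrow> ('a, 'f, 'r) struct \<Rightarrow> ('f, 'r) eqsort \<Rightarrow> bool" where
  "valid_sort L M Home \<longleftrightarrow> True"
| "valid_sort L M (Imag n E) \<longleftrightarrow>
     E \<in> formulas L \<and> fv E \<subseteq> {..<n + n} \<and> equiv (tuples n) (imag_rel M n E)"

fun sort_dom :: "('a, 'f, 'r) struct \<Rightarrow> ('f, 'r) eqsort \<Rightarrow> 'a eqelem set" where
  "sort_dom M Home = range Pt"
| "sort_dom M (Imag n E) = Cls ` (tuples n // imag_rel M n E)"

text \<open>Many-sorted formulas of \<open>L\<^sup>e\<^sup>q\<close>. Variables are pairs of a sort and an index.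
  \<open>QHome \<phi>\<close> is the \<open>L\<close>-formula \<open>\<phi>\<close> read in the variables of the home sort, and
  \<open>QProj n E js i\<close> says that the projection to \<open>Imag n E\<close> of the tuple of home variables listed
  in \<open>js\<close> is the \<open>i\<close>-th variable of sort \<open>Imag n E\<close>.\<close>

datatype ('f, 'r) eqfm =
    QHome "('f, 'r) fm"
  | QProj nat "('f, 'r) fm" "nat list" nat
  | QEq "('f, 'r) eqsort" nat nat
  | QNeg "('f, 'r) eqfm"
  | QConj "('f, 'r) eqfm" "('f, 'r) eqfm"
  | QEx "('f, 'r) eqsort" nat "('f, 'r) eqfm"

primrec wf_eqfm :: "('f, 'r) lang \<Rightarrow> ('a, 'f, 'r) struct \<Rightarrow> ('f, 'r) eqfm \<Rightarrow> bool" where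
  "wf_eqfm L M (QHome \<phi>) \<longleftrightarrow> \<phi> \<in> formulas L"
| "wf_eqfm L M (QProj n E js i) \<longleftrightarrow> valid_sort L M (Imag n E) \<and> length js = n"
| "wf_eqfm L M (QEq s i j) \<longleftrightarrow> valid_sort L M s"
| "wf_eqfm L M (QNeg \<chi>) \<longleftrightarrow> wf_eqfm L M \<chi>"
| "wf_eqfm L M (QConj \<chi> \<xi>) \<longleftrightarrow> wf_eqfm L M \<chi> \<and> wf_eqfm L M \<xi>"
| "wf_eqfm L M (QEx s i \<chi>) \<longleftrightarrow> valid_sort L M s \<and> wf_eqfm L M \<chi>"

primrec fv_eqfm :: "('f, 'r) eqfm \<Rightarrow> (('f, 'r) eqsort \<times> nat) set" where
  "fv_eqfm (QHome \<phi>) = Pair Home ` fv \<phi>"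
| "fv_eqfm (QProj n E js i) = insert (Imag n E, i) (Pair Home ` set js)"
| "fv_eqfm (QEq s i j) = {(s, i), (s, j)}"
| "fv_eqfm (QNeg \<chi>) = fv_eqfm \<chi>"
| "fv_eqfm (QConj \<chi> \<xi>) = fv_eqfm \<chi> \<union> fv_eqfm \<xi>"
| "fv_eqfm (QEx s i \<chi>) = fv_eqfm \<chi> - {(s, i)}"

primrec eqsat ::
  "('a, 'f, 'r) struct \<Rightarrow> (('f, 'r) eqsort \<times> nat \<Rightarrow> 'a eqelem) \<Rightarrow> ('f, 'r) eqfm \<Rightarrow> bool" where
  "eqsat M v (QHome \<phi>) \<longleftrightarrow> sat M (\<lambda>i. pt (v (Home, i))) \<phi>"
| "eqsat M v (QProj n E js i) \<longleftrightarrow>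
     v (Imag n E, i) = Cls (imag_rel M n E `` {\<lambda>t\<in>{..<n}. pt (v (Home, js ! t))})"
| "eqsat M v (QEq s i j) \<longleftrightarrow> v (s, i) = v (s, j)"
| "eqsat M v (QNeg \<chi>) \<longleftrightarrow> \<not> eqsat M v \<chi>"
| "eqsat M v (QConj \<chi> \<xi>) \<longleftrightarrow> eqsat M v \<chi> \<and> eqsat M v \<xi>"
| "eqsat M v (QEx s i \<chi>) \<longleftrightarrow> (\<exists>c\<in>sort_dom M s. eqsat M (v((s, i) := c)) \<chi>)"

text \<open>\<open>acl\<^sup>e\<^sup>q(\<emptyset>)\<close>, as a set of elements tagged with their sort. The valuation \<open>v\<close> below is
  irrelevant, as \<open>(s, 0)\<close> is the only free variable.\<close>

definition acl_eq_empty ::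
  "('f, 'r) lang \<Rightarrow> ('a, 'f, 'r) struct \<Rightarrow> (('f, 'r) eqsort \<times> 'a eqelem) set" where
  "acl_eq_empty L M = {(s, c). valid_sort L M s \<and>
     (\<exists>\<chi> v. wf_eqfm L M \<chi> \<and> fv_eqfm \<chi> \<subseteq> {(s, 0)} \<and>
        finite {d \<in> sort_dom M s. eqsat M (v((s, 0) := d)) \<chi>} \<and>
        c \<in> {d \<in> sort_dom M s. eqsat M (v((s, 0) := d)) \<chi>})}"

definition acl_eq_empty_definable ::
  "('f, 'r) lang \<Rightarrow> ('a, 'f, 'r) struct \<Rightarrow> nat \<Rightarrow> (nat \<Rightarrow> 'a) set \<Rightarrow> bool" where
  "acl_eq_empty_definable L M m X \<longleftrightarrow>
     (\<exists>\<chi> v. wf_eqfm L M \<chi> \<and>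
        (\<forall>(s, i)\<in>fv_eqfm \<chi>. (s = Home \<and> i < m) \<or> (s, v (s, i)) \<in> acl_eq_empty L M) \<and>
        X = {x \<in> tuples m.
               eqsat M (\<lambda>(s, i). if s = Home \<and> i < m then Pt (x i) else v (s, i)) \<chi>})"


section \<open>One-based groups\<close>

text \<open>A group with additional structure is a structure whose language has a distinguished binary
  function symbol interpreted as a group law. Identity and inversion are definable from it.\<close>

definition str_group :: "'f \<Rightarrow> ('a, 'f, 'r) struct \<Rightarrow> 'a monoid" where
  "str_group mul M =
     \<lparr>carrier = UNIV,
      mult = (\<lambda>a b. fint M mul [a, b]),
      one = (THE e. \<forall>a. fint M mul [e, a] = a \<and> fint M mul [a, e] = a)\<rparr>"

definition group_structure :: "('f, 'r) lang \<Rightarrow> 'f \<Rightarrow> ('a, 'f, 'r) struct \<Rightarrow> bool" where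
  "group_structure L mul M \<longleftrightarrow>
     mul \<in> fsyms L \<and> farity L mul = 2 \<and> group (str_group mul M)"

abbreviation group_power :: "'f \<Rightarrow> ('a, 'f, 'r) struct \<Rightarrow> nat \<Rightarrow> (nat \<Rightarrow> 'a) monoid" where
  "group_power mul M m \<equiv> product_group {..<m} (\<lambda>_. str_group mul M)"

inductive_set bool_combs :: "'b set \<Rightarrow> 'b set set \<Rightarrow> 'b set set"
  for U :: "'b set" and B :: "'b set set" where
  basic: "X \<in> B \<Longrightarrow> X \<in> bool_combs U B"
| compl: "X \<in> bool_combs U B \<Longrightarrow> U - X \<in> bool_combs U B"
| inter: "X \<in> bool_combs U B \<Longrightarrow> Y \<in> bool_combs U B \<Longrightarrow> X \<inter> Y \<in> bool_combs U B"

text \<open>Left cosets are used; since inversion permutes the definable sets and exchanges left and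
  right cosets of a subgroup, right cosets give the same notion.\<close>

definition one_based_group :: "('f, 'r) lang \<Rightarrow> 'f \<Rightarrow> ('a, 'f, 'r) struct \<Rightarrow> bool" where
  "one_based_group L mul M \<longleftrightarrow>
     group_structure L mul M \<and>
     (\<forall>m X. definable_over L M UNIV m X \<longrightarrow>
        X \<in> bool_combs (tuples m)
          {g <#\<^bsub>group_power mul M m\<^esub> H | g H.
             g \<in> tuples m \<and> subgroup H (group_power mul M m) \<and>
             acl_eq_empty_definable L M m H})"


section \<open>dp-rank\<close>

text \<open>The depth is the cardinality of the index set \<open>I\<close>. The parameter tuple \<open>b \<alpha> i\<close> is given as
  a valuation of the variables other than \<open>0\<close>.\<close>

definition inp_pattern ::
  "('f, 'r) lang \<Rightarrow> ('a, 'f, 'r) struct \<Rightarrow> ('a, 'f, 'r) pfm set \<Rightarrow> 'i set \<Rightarrow>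
   ('i \<Rightarrow> ('f, 'r) fm) \<Rightarrow> ('i \<Rightarrow> nat) \<Rightarrow> bool" where
  "inp_pattern L M \<pi> I \<phi> k \<longleftrightarrow>
     (\<forall>\<alpha>\<in>I. \<phi> \<alpha> \<in> formulas L) \<and>
     (\<exists>b :: 'i \<Rightarrow> nat \<Rightarrow> nat \<Rightarrow> 'a.
        (\<forall>\<alpha>\<in>I. \<forall>J. finite J \<and> card J = k \<alpha> \<longrightarrow>
            \<not> consistent M ((\<lambda>i. (\<phi> \<alpha>, b \<alpha> i)) ` J)) \<and>
        (\<forall>\<eta> :: 'i \<Rightarrow> nat. consistent M (\<pi> \<union> (\<lambda>\<alpha>. (\<phi> \<alpha>, b \<alpha> (\<eta> \<alpha>))) ` I)))"

text \<open>All infinite depths are recorded as \<open>\<infinity>\<close>; a pattern of infinite depth restricts to one of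
  depth \<open>\<aleph>\<^sub>0\<close>, so countable index sets are enough.\<close>

definition dp_rank ::
  "('f, 'r) lang \<Rightarrow> ('a, 'f, 'r) struct \<Rightarrow> ('a, 'f, 'r) pfm set \<Rightarrow> enat" where
  "dp_rank L M \<pi> = Sup {d. \<exists>\<phi> k. inp_pattern L M \<pi> {\<alpha> :: nat. enat \<alpha> < d} \<phi> k}"

definition dp_rank_structure :: "('f, 'r) lang \<Rightarrow> ('a, 'f, 'r) struct \<Rightarrow> enat" where
  "dp_rank_structure L M = dp_rank L M {(Eq (Var 0) (Var 0), \<lambda>_. undefined)}"


section \<open>vc-density\<close>

text \<open>The supremum is a maximum, except that it is \<open>0\<close> when \<open>X\<close> has fewer than \<open>n\<close> elements.\<close>

definition shatter_fun :: "'b set \<Rightarrow> 'b set set \<Rightarrow> nat \<Rightarrow> nat" where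
  "shatter_fun X S n = Sup {card {C \<inter> A | C. C \<in> S} | A. A \<subseteq> X \<and> finite A \<and> card A = n}"

definition vc :: "'b set \<Rightarrow> 'b set set \<Rightarrow> ereal" where
  "vc X S = Inf {ereal r | r. 0 \<le> r \<and>
     (\<lambda>n. real (shatter_fun X S n)) \<in> O(\<lambda>n. real n powr r)}"

text \<open>In \<open>\<phi>(x;y)\<close> with \<open>|x| = k\<close> and \<open>|y| = n\<close>, the tuple \<open>x\<close> consists of the variables
  \<open>0, \<dots>, k - 1\<close> and \<open>y\<close> of the variables \<open>k, \<dots>, k + n - 1\<close>.\<close>

definition def_family ::
  "('a, 'f, 'r) struct \<Rightarrow> nat \<Rightarrow> nat \<Rightarrow> ('f, 'r) fm \<Rightarrow> (nat \<Rightarrow> 'a) set set" where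
  "def_family M k n \<phi> = {{a \<in> tuples k. sat M (join k a b) \<phi>} | b. b \<in> tuples n}"

text \<open>The value at \<open>n\<close> of the vc-density of the theory of \<open>M\<close>, for \<open>M\<close> sufficiently saturated.\<close>

definition vc_density :: "('f, 'r) lang \<Rightarrow> ('a, 'f, 'r) struct \<Rightarrow> nat \<Rightarrow> ereal" where
  "vc_density L M n =
     Sup {vc (tuples k) (def_family M k n \<phi>) | k \<phi>.
            \<phi> \<in> formulas L \<and> fv \<phi> \<subseteq> {..<k + n}}"

end

theory Submission
  imports Defs
begin

text \<open>
  Write \<open>H \<lesssim> K\<close> (\<open>virt_sub\<close>) if \<open>H\<close> meets only finitely many left cosets of \<open>K\<close>, and call subgroups \<open>K\<^sub>1, \<dots>, K\<^sub>d\<close>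
  independent if no \<open>K\<^sub>i\<close> satisfies \<open>\<Inter>\<^sub>j\<^sub>\<noteq>\<^sub>i K\<^sub>j \<lesssim> K\<^sub>i\<close>. If \<open>d\<close> is the largest size of an independent family
  of definable subgroups of the group \<open>A\<close>, then \<open>m d\<close> is the vc-density at \<open>m\<close>.

  Upper bound: the fibres in \<open>A\<^sup>m\<close> of a definable set are determined by cosets of finitely many subgroups
  of \<open>A\<^sup>m\<close>. A nonempty intersection of such cosets is determined, up to finitely many choices, by those
  belonging to an independent subfamily \<open>J\<close>, so a formula has \<open>O(n\<^bsup>|J|\<^esup>)\<close> traces on \<open>n\<close> points; and
  \<open>|J| \<le> m d\<close>, by splitting off one coordinate of \<open>A\<^sup>m\<close> at a time.

  Lower bound: the graphs of the inner automorphisms are uniformly definable, hence fall into finitely many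
  commensurability classes, which makes \<open>A\<close> abelian-by-finite. In an abelian group one can prescribe
  independently the cosets of \<open>K\<^sub>1, \<dots>, K\<^sub>d\<close> containing an element; doing so in each of the \<open>m\<close>
  coordinates gives \<open>n\<^bsup>m d\<^esup>\<close> traces on \<open>m d n\<close> points. If \<open>d\<close> does not exist, both sides are \<open>\<infinity>\<close>.
\<close>


section \<open>Virtual containment of subgroups\<close>

text \<open>For subgroups this says that the index of \<open>H \<inter> K\<close> in
  \<open>H\<close> is finite. Counting cosets of \<open>K\<close> in the ambient group avoids
  forming the intersection and makes sense for any set \<open>H\<close>.\<close>

definition virt_sub :: "('a, 'b) monoid_scheme \<Rightarrow> 'a set \<Rightarrow> 'a set \<Rightarrow> bool" where
  "virt_sub G H K \<longleftrightarrow> finite ((\<lambda>h. h <#\<^bsub>G\<^esub> K) ` H)"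

lemma finite_image_representatives:
  assumes "finite (f ` A)"
  obtains R where "R \<subseteq> A" "finite R" "f ` A = f ` R"
proof -
  have "\<exists>R\<subseteq>A. finite R \<and> f ` A = f ` R"
    by (rule finite_subset_image[OF assms order_refl])
  then show thesis using that by (elim exE conjE)
qed

lemma virt_sub_mono_left: "virt_sub G H K \<Longrightarrow> H' \<subseteq> H \<Longrightarrow> virt_sub G H' K"
  unfolding virt_sub_def by (meson finite_subset image_mono)

context group
begin

section \<open>Left cosets of a subgroup\<close>

lemma mult_inv_mult_cancel: "x \<in> carrier G \<Longrightarrow> y \<in> carrier G \<Longrightarrow> x \<otimes> (inv x \<otimes> y) = y"
  by (simp flip: m_assoc)

lemma inv_mult_mult_cancel: "x \<in> carrier G \<Longrightarrow> y \<in> carrier G \<Longrightarrow> inv x \<otimes> (x \<otimes> y) = y"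
  by (simp flip: m_assoc)

lemma mem_lcos_iff:
  assumes "subgroup K G" "x \<in> carrier G" "y \<in> carrier G"
  shows "y \<in> x <# K \<longleftrightarrow> inv x \<otimes> y \<in> K"
proof
  assume "y \<in> x <# K"
  then obtain k where "k \<in> K" "y = x \<otimes> k" by (auto simp: l_coset_def)
  then show "inv x \<otimes> y \<in> K"
    using assms subgroup.mem_carrier[OF assms(1)] by (simp add: inv_mult_mult_cancel)
next
  assume "inv x \<otimes> y \<in> K"
  then show "y \<in> x <# K"
    using assms by (force simp: l_coset_def mult_inv_mult_cancel)
qed

lemma mem_lcos_iff_mult:
  assumes "subgroup K G" "x \<in> carrier G" "y \<in> carrier G"
  shows "x \<otimes> y \<in> x <# K \<longleftrightarrow> y \<in> K"
  using assms by (simp add: mem_lcos_iff inv_mult_mult_cancel)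

lemma lcos_carrier:
  assumes "subgroup K G" "x \<in> carrier G" "y \<in> x <# K"
  shows "y \<in> carrier G"
  using assms l_coset_subset_G subgroup.subset by blast

lemma lcos_eq_iff:
  assumes K: "subgroup K G" and x: "x \<in> carrier G" and y: "y \<in> carrier G"
  shows "x <# K = y <# K \<longleftrightarrow> inv x \<otimes> y \<in> K"
proof
  assume "x <# K = y <# K"
  moreover have "y \<in> y <# K"
    using mem_lcos_iff[OF K y y] K y subgroup.one_closed by fastforce
  ultimately show "inv x \<otimes> y \<in> K"
    using mem_lcos_iff[OF K x y] by simp
next
  assume *: "inv x \<otimes> y \<in> K"
  have "z \<in> x <# K \<longleftrightarrow> z \<in> y <# K" if z: "z \<in> carrier G" for z
  proof -
    have eq: "inv x \<otimes> z = (inv x \<otimes> y) \<otimes> (inv y \<otimes> z)"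
      using x y z by (simp add: m_assoc mult_inv_mult_cancel)
    have "inv x \<otimes> z \<in> K \<longleftrightarrow> inv y \<otimes> z \<in> K"
    proof
      assume "inv y \<otimes> z \<in> K" then show "inv x \<otimes> z \<in> K"
        unfolding eq using * K by (simp add: subgroup.m_closed)
    next
      assume "inv x \<otimes> z \<in> K"
      then have "inv (inv x \<otimes> y) \<otimes> (inv x \<otimes> z) \<in> K"
        using * K by (simp add: subgroup.m_closed subgroup.m_inv_closed)
      then show "inv y \<otimes> z \<in> K"
        unfolding eq using x y z by (simp add: inv_mult_mult_cancel)
    qed
    then show ?thesis
      using mem_lcos_iff[OF K] x y z by simp
  qed
  then show "x <# K = y <# K"
    using lcos_carrier[OF K] x y by blast
qed

lemma mem_lcos_self: "subgroup K G \<Longrightarrow> x \<in> carrier G \<Longrightarrow> x \<in> x <# K"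
  by (simp add: mem_lcos_iff subgroup.one_closed)

lemma lcos_eqI: "subgroup K G \<Longrightarrow> x \<in> carrier G \<Longrightarrow> y \<in> x <# K \<Longrightarrow> y <# K = x <# K"
  by (metis lcos_carrier lcos_eq_iff mem_lcos_iff)

section \<open>Closure properties of virtual containment\<close>

lemma virt_sub_subset:
  assumes "subgroup K G" "H \<subseteq> K"
  shows "virt_sub G H K"
proof -
  have "(\<lambda>h. h <# K) ` H \<subseteq> {\<one> <# K}"
    using assms lcos_eq_iff[OF assms(1) one_closed] subgroup.mem_carrier[OF assms(1)] by auto
  then show ?thesis
    unfolding virt_sub_def by (meson finite.emptyI finite.insertI finite_subset)
qed

text \<open>\<open>H\<close> is covered by finitely many cosets r K with r in \<open>H\<close>, and
  \<open>K\<close> by finitely many cosets of \<open>L\<close>. Since h L = r (r^-1 h) L with r^-1 h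
  in \<open>K\<close>, only finitely many cosets of \<open>L\<close> arise.\<close>

lemma virt_sub_trans:
  assumes H: "H \<subseteq> carrier G" and K: "subgroup K G" and L: "subgroup L G"
    and HK: "virt_sub G H K" and KL: "virt_sub G K L"
  shows "virt_sub G H L"
proof -
  obtain R where R: "R \<subseteq> H" "finite R" "(\<lambda>h. h <# K) ` H = (\<lambda>h. h <# K) ` R"
    by (rule finite_image_representatives[OF HK[unfolded virt_sub_def]])
  have "(\<lambda>h. h <# L) ` H \<subseteq> (\<lambda>(r, c). r <# c) ` (R \<times> (\<lambda>k. k <# L) ` K)"
  proof
    fix c assume "c \<in> (\<lambda>h. h <# L) ` H"
    then obtain h where h: "h \<in> H" "c = h <# L" by blast
    obtain r where r: "r \<in> R" "h <# K = r <# K"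
      using imageI[OF h(1), of "\<lambda>h. h <# K"] unfolding R(3) by (elim imageE) simp
    have rc: "r \<in> carrier G" and hc: "h \<in> carrier G" using r R h H by auto
    have k: "inv r \<otimes> h \<in> K" using lcos_eq_iff[OF K rc hc] r by simp
    have "r <# ((inv r \<otimes> h) <# L) = h <# L"
      using rc hc L by (simp add: lcos_m_assoc subgroup.subset mult_inv_mult_cancel)
    then show "c \<in> (\<lambda>(r, c). r <# c) ` (R \<times> (\<lambda>k. k <# L) ` K)"
      using k r h by (intro image_eqI[of _ _ "(r, (inv r \<otimes> h) <# L)"]) auto
  qed
  moreover have "finite ((\<lambda>(r, c). r <# c) ` (R \<times> (\<lambda>k. k <# L) ` K))"
    using R KL unfolding virt_sub_def by blast
  ultimately show ?thesis
    unfolding virt_sub_def by (rule finite_subset)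
qed

lemma subgroup_INT:
  assumes "\<And>i. i \<in> I \<Longrightarrow> subgroup (K i) G" "subgroup N G"
  shows "subgroup (N \<inter> \<Inter>(K ` I)) G"
proof -
  have "subgroup (\<Inter>(insert N (K ` I))) G"
    by (rule subgroups_Inter) (use assms in auto)
  then show ?thesis by simp
qed

text \<open>For h in \<open>H\<close>, the coset of the intersection through h is determined by the
  finitely many cosets h K_i, each of which has finitely many values. The factor \<open>N\<close>
  keeps the intersection inside the group when \<open>I\<close> is empty.\<close>

lemma virt_sub_INT:
  assumes H: "H \<subseteq> N" and N: "subgroup N G" and I: "finite I"
    and K: "\<And>i. i \<in> I \<Longrightarrow> subgroup (K i) G" "\<And>i. i \<in> I \<Longrightarrow> virt_sub G H (K i)"
  shows "virt_sub G H (N \<inter> \<Inter>(K ` I))"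
proof -
  let ?D = "N \<inter> \<Inter>(K ` I)"
  have D: "subgroup ?D G" by (rule subgroup_INT[OF K(1) N])
  have Hc: "H \<subseteq> carrier G" by (rule order_trans[OF H subgroup.subset[OF N]])
  define c where "c = (\<lambda>h. \<lambda>i\<in>I. h <# K i)"
  have "c ` H \<subseteq> (\<Pi>\<^sub>E i\<in>I. (\<lambda>h. h <# K i) ` H)"
    by (auto simp: c_def)
  moreover have "finite (\<Pi>\<^sub>E i\<in>I. (\<lambda>h. h <# K i) ` H)"
    using I K(2) by (intro finite_PiE) (auto simp: virt_sub_def)
  ultimately have "finite (c ` H)" by (rule finite_subset)
  then obtain R where R: "R \<subseteq> H" "finite R" "c ` H = c ` R"
    by (rule finite_image_representatives)
  have "(\<lambda>h. h <# ?D) ` H \<subseteq> (\<lambda>h. h <# ?D) ` R"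
  proof
    fix x assume "x \<in> (\<lambda>h. h <# ?D) ` H"
    then obtain h where h: "h \<in> H" "x = h <# ?D" by blast
    obtain r where r: "r \<in> R" "c h = c r"
      using imageI[OF h(1), of c] unfolding R(3) by (elim imageE) simp
    have rh: "r \<in> carrier G" "h \<in> carrier G" "r \<in> N" "h \<in> N" using r h R Hc H by auto
    have "inv r \<otimes> h \<in> K i" if "i \<in> I" for i
      using fun_cong[OF r(2), of i] that lcos_eq_iff[OF K(1)[OF that] rh(1,2)] by (simp add: c_def)
    moreover have "inv r \<otimes> h \<in> N"
      using rh N by (simp add: subgroup.m_closed subgroup.m_inv_closed)
    ultimately have "r <# ?D = h <# ?D"
      by (subst lcos_eq_iff[OF D rh(1,2)]) blast
    then show "x \<in> (\<lambda>h. h <# ?D) ` R" using h r by blast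
  qed
  then show ?thesis
    unfolding virt_sub_def using R(2) by (meson finite_imageI finite_subset)
qed

lemma virt_sub_Int:
  assumes "H \<subseteq> carrier G" "subgroup K G" "subgroup L G" "virt_sub G H K" "virt_sub G H L"
  shows "virt_sub G H (K \<inter> L)"
proof -
  have "virt_sub G H (carrier G \<inter> \<Inter>(id ` {K, L}))"
    by (rule virt_sub_INT) (use assms subgroup_self in auto)
  moreover have "carrier G \<inter> \<Inter>(id ` {K, L}) = K \<inter> L"
    using assms(2) subgroup.subset by auto
  ultimately show ?thesis by simp
qed

lemma subgroup_vimage:
  assumes "group M" "f \<in> hom G M" "subgroup K M" 
  shows "subgroup {x \<in> carrier G. f x \<in> K} G"
proof -
  interpret M: group M by fact
  interpret f: group_hom G M f
    using assms by (simp add: group_hom_def group_hom_axioms_def is_group)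
  show ?thesis
    by unfold_locales (use assms in \<open>auto simp: subgroup.m_closed subgroup.m_inv_closed subgroup.one_closed\<close>)
qed

text \<open>The coset of the preimage through h is the preimage of the coset f(h) K, so there are at
  most as many of them as cosets of \<open>K\<close> met by the image of \<open>H\<close>.\<close>

lemma virt_sub_vimage:
  assumes M: "group M" and f: "f \<in> hom G M" and H: "H \<subseteq> carrier G" and K: "subgroup K M"
    and HK: "virt_sub M (f ` H) K"
  shows "virt_sub G H {x \<in> carrier G. f x \<in> K}"
proof -
  interpret M: group M by fact
  interpret f: group_hom G M f
    using M f by (simp add: group_hom_def group_hom_axioms_def is_group)
  let ?V = "{x \<in> carrier G. f x \<in> K}"
  have V: "subgroup ?V G" using subgroup_vimage M f K .
  have "(\<lambda>h. h <# ?V) ` H \<subseteq> (\<lambda>c. {x \<in> carrier G. f x \<in> c}) ` (\<lambda>h. h <#\<^bsub>M\<^esub> K) ` f ` H"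
  proof
    fix c assume "c \<in> (\<lambda>h. h <# ?V) ` H"
    then obtain h where h: "h \<in> H" "c = h <# ?V" by blast
    have hc: "h \<in> carrier G" using h H by blast
    have "c = {x \<in> carrier G. f x \<in> f h <#\<^bsub>M\<^esub> K}"
    proof -
      have "x \<in> h <# ?V \<longleftrightarrow> f x \<in> f h <#\<^bsub>M\<^esub> K" if x: "x \<in> carrier G" for x
        unfolding mem_lcos_iff[OF V hc x] M.mem_lcos_iff[OF K f.hom_closed[OF hc] f.hom_closed[OF x]]
        using hc x by simp
      then show ?thesis
        unfolding h(2) using lcos_carrier[OF V hc] by blast
    qed
    then show "c \<in> (\<lambda>c. {x \<in> carrier G. f x \<in> c}) ` (\<lambda>h. h <#\<^bsub>M\<^esub> K) ` f ` H"
      using h by blast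
  qed
  then show ?thesis
    using HK unfolding virt_sub_def by (meson finite_imageI finite_subset)
qed

section \<open>Coverings of a group by cosets\<close>

text \<open>B. H. Neumann's lemma. A coset \<open>h K\<close> missing from the covering is covered by the cosets of the
  other subgroups, hence so is every coset of \<open>K\<close>, and \<open>K\<close> can be dropped.\<close>

lemma neumann:
  assumes H: "subgroup H G" and S: "finite S" "\<And>K. K \<in> S \<Longrightarrow> subgroup K G"
    and C: "finite C" "\<And>c. c \<in> C \<Longrightarrow> \<exists>K\<in>S. \<exists>g\<in>carrier G. c = g <# K" "H \<subseteq> \<Union>C"
  shows "\<exists>K\<in>S. virt_sub G H K"
  using S C
proof (induction S arbitrary: C rule: finite_induct)
  case empty
  then have "H = {}" by blast
  then show ?case using H subgroup.one_closed by blast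
next
  case (insert K S)
  show ?case
  proof (rule ccontr)
    assume no: "\<not> ?case"
    have K: "subgroup K G" using insert.prems by blast
    from no have inf: "infinite ((\<lambda>h. h <# K) ` H)" by (auto simp: virt_sub_def)
    then obtain h where h: "h \<in> H" "h <# K \<notin> C"
      by (metis (no_types, lifting) finite_subset image_subsetI insert.prems(2))
    have hc: "h \<in> carrier G" using h H subgroup.mem_carrier by fastforce
    define CK where "CK = C \<inter> {c. \<exists>g\<in>carrier G. c = g <# K}"
    define CS where "CS = {c\<in>C. \<exists>L\<in>S. \<exists>g\<in>carrier G. c = g <# L}"
    obtain R where R: "R \<subseteq> H" "finite R"
        "(\<lambda>h. h <# K) ` H \<inter> CK = (\<lambda>h. h <# K) ` R"
    proof -
      have "finite ((\<lambda>h. h <# K) ` H \<inter> CK)" using insert.prems by (simp add: CK_def)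
      then show ?thesis using that
        by (metis Int_lower1 finite_subset_image)
    qed
    \<comment> \<open>Translation by r h^-1 carries h K to r K. As h K is not in \<open>C\<close>,
      the part of \<open>H\<close> in h K is covered by \<open>CS\<close>, so the translates of
      \<open>CS\<close> cover the part of \<open>H\<close> in each coset r K that occurs in
      \<open>C\<close>.\<close>
    define C' where "C' = CS \<union> (\<lambda>(r, c). (r \<otimes> inv h) <# c) ` (R \<times> CS)"
    have "finite C'" using R insert.prems by (simp add: C'_def CS_def)
    moreover have "\<exists>L\<in>S. \<exists>g\<in>carrier G. c = g <# L" if c: "c \<in> C'" for c
    proof (cases "c \<in> CS")
      case True
      then show ?thesis by (simp add: CS_def)
    next
      case False
      then obtain r d where rd: "r \<in> R" "d \<in> CS" "c = (r \<otimes> inv h) <# d"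
        using c by (auto simp: C'_def)
      then obtain L g where L: "L \<in> S" "g \<in> carrier G" "d = g <# L" by (auto simp: CS_def)
      have rc: "r \<in> carrier G" using rd R H subgroup.mem_carrier by fastforce
      have "c = ((r \<otimes> inv h) \<otimes> g) <# L"
        using rd L rc hc insert.prems(1)[of L] by (simp add: lcos_m_assoc subgroup.subset)
      then show ?thesis using L rc hc by blast
    qed
    moreover have "H \<subseteq> \<Union>C'"
    proof
      fix x assume x: "x \<in> H"
      have xc: "x \<in> carrier G" using x H subgroup.mem_carrier by fastforce
      obtain c where c: "c \<in> C" "x \<in> c" using x insert.prems by blast
      obtain L g where L: "L \<in> insert K S" "g \<in> carrier G" "c = g <# L"
        using insert.prems(3)[OF c(1)] by blast
      show "x \<in> \<Union>C'"
      proof (cases "c \<in> CS")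
        case True
        then show ?thesis using c by (auto simp: C'_def)
      next
        case False
        then have LK: "L = K" using L c by (auto simp: CS_def)
        have "c = x <# K" using L LK c lcos_eqI[OF K] by metis
        then have "x <# K \<in> (\<lambda>h. h <# K) ` R"
          unfolding R(3)[symmetric] CK_def using c x xc by blast
        then obtain r where r: "r \<in> R" "x <# K = r <# K" by blast
        have rH: "r \<in> H" and rc: "r \<in> carrier G" using r R H subgroup.mem_carrier by fastforce+
        have k: "inv r \<otimes> x \<in> K" using lcos_eq_iff[OF K rc xc] r by simp
        define y where "y = h \<otimes> (inv r \<otimes> x)"
        have yH: "y \<in> H"
          unfolding y_def using h rH x H by (simp add: subgroup.m_closed subgroup.m_inv_closed)
        have yc: "y \<in> carrier G" using yH H subgroup.mem_carrier by fastforce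
        have "inv h \<otimes> y \<in> K" unfolding y_def using hc rc xc k by (simp add: inv_mult_mult_cancel)
        then have yK: "h <# K = y <# K" using lcos_eq_iff[OF K hc yc] by simp
        obtain d where d: "d \<in> C" "y \<in> d" using yH insert.prems by blast
        have "d \<in> CS"
        proof (rule ccontr)
          assume "d \<notin> CS"
          then obtain g' where "g' \<in> carrier G" "d = g' <# K"
            using d insert.prems(3)[OF d(1)] by (auto simp: CS_def)
          then have "d = h <# K" using d yK lcos_eqI[OF K] by metis
          then show False using h d by simp
        qed
        moreover have "x \<in> (r \<otimes> inv h) <# d"
        proof -
          have "x = (r \<otimes> inv h) \<otimes> y"
            unfolding y_def using hc rc xc
            by (simp add: m_assoc inv_mult_mult_cancel mult_inv_mult_cancel)
          then show ?thesis using d by (auto simp: l_coset_def)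
        qed
        ultimately show ?thesis
          using r by (force simp: C'_def)
      qed
    qed
    ultimately have "\<exists>K\<in>S. virt_sub G H K"
      using insert.IH[of C'] insert.prems(1) by blast
    then show False using no by blast
  qed
qed

text \<open>If \<open>u\<close> lies in all \<open>L c\<close> with \<open>c \<in> I\<close>, then for a generic \<open>z\<close> of \<open>H\<close> in these \<open>L c\<close> the
  points \<open>z\<close> and \<open>u z\<close> lie in the same cosets, so that \<open>u z \<in> H\<close>.\<close>

lemma subgroup_determined_by_cosets:
  assumes H: "subgroup H G" and F: "finite F" "\<And>c. c \<in> F \<Longrightarrow> subgroup (L c) G"
    and S: "\<And>c x. c \<in> F \<Longrightarrow> x \<in> S c \<Longrightarrow> x \<in> carrier G \<and> S c = x <# L c"
    and det: "\<And>x y. x \<in> carrier G \<Longrightarrow> y \<in> carrier G \<Longrightarrow> (\<forall>c\<in>F. x \<in> S c \<longleftrightarrow> y \<in> S c) \<Longrightarrow> x \<in> H \<longleftrightarrow> y \<in> H"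
  shows "carrier G \<inter> \<Inter>(L ` {c\<in>F. virt_sub G H (L c)}) \<subseteq> H"
proof
  let ?I = "{c\<in>F. virt_sub G H (L c)}"
  fix u assume u: "u \<in> carrier G \<inter> \<Inter>(L ` ?I)"
  let ?W = "H \<inter> \<Inter>(L ` ?I)"
  have W: "subgroup ?W G" by (rule subgroup_INT) (use F H in auto)
  have HW: "virt_sub G H ?W"
    by (rule virt_sub_INT) (use F H in auto)
  have Hc: "H \<subseteq> carrier G" by (rule subgroup.subset[OF H])
  \<comment> \<open>For a point z outside all sets of \<open>B\<close>, neither z nor u z lies in
    any \<open>S c\<close> with \<open>c\<close> outside \<open>?I\<close>. The empty set is removed
    because only nonempty \<open>S c\<close> are known to be cosets.\<close>
  define B where "B = S ` (F - ?I) \<union> (\<lambda>c. inv u <# S c) ` (F - ?I) - {{}}"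
  have "\<not> ?W \<subseteq> \<Union>B"
  proof
    assume cov: "?W \<subseteq> \<Union>B"
    have "\<exists>K\<in>L ` (F - ?I). virt_sub G ?W K"
    proof (rule neumann[OF W _ _ _ _ cov])
      show "finite (L ` (F - ?I))" using F by simp
      show "finite B" using F by (simp add: B_def)
      show "\<And>K. K \<in> L ` (F - ?I) \<Longrightarrow> subgroup K G" using F by auto
      fix c assume c: "c \<in> B"
      then obtain f where f: "f \<in> F - ?I" "c = S f \<or> c = inv u <# S f" "S f \<noteq> {}"
        by (auto simp: B_def l_coset_def)
      then obtain x where x: "x \<in> S f" by blast
      have xx: "x \<in> carrier G" "S f = x <# L f" using S[of f x] f x by auto
      have "inv u <# S f = (inv u \<otimes> x) <# L f"
        using xx u F f by (simp add: lcos_m_assoc subgroup.subset)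
      note eq = this
      show "\<exists>K\<in>L ` (F - ?I). \<exists>g\<in>carrier G. c = g <# K"
      proof (rule bexI[OF _ imageI[OF f(1)]])
        have "inv u \<otimes> x \<in> carrier G" using u xx by simp
        then show "\<exists>g\<in>carrier G. c = g <# L f"
          using f(2) xx eq by metis
      qed
    qed
    then obtain c where c: "c \<in> F - ?I" "virt_sub G ?W (L c)" by blast
    \<comment> \<open>\<open>?W\<close> is virtually all of \<open>H\<close>, so a subgroup
      virtually containing \<open>?W\<close> virtually contains \<open>H\<close>, and its index
      would belong to \<open>?I\<close>.\<close>
    then have "virt_sub G H (L c)" using virt_sub_trans[OF Hc W _ HW] F by auto
    then show False using c by blast
  qed
  then obtain z where z: "z \<in> ?W" "z \<notin> \<Union>B" by blast
  have zc: "z \<in> carrier G" and uc: "u \<in> carrier G" using z u Hc by auto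
  have "z \<in> S c \<longleftrightarrow> u \<otimes> z \<in> S c" if c: "c \<in> F" for c
  proof (cases "c \<in> ?I")
    case True
    have L: "subgroup (L c) G" and uz: "u \<in> L c" "z \<in> L c" using True F u z by auto
    have uzL: "u \<otimes> z \<in> L c" using uz L by (simp add: subgroup.m_closed)
    have aux: "b \<in> S c" if "a \<in> S c" "a \<in> L c" "b \<in> L c" for a b
    proof -
      have "a \<in> carrier G" "S c = a <# L c" using S[OF c \<open>a \<in> S c\<close>] by auto
      moreover have "b \<in> carrier G" using that L subgroup.mem_carrier by fastforce
      ultimately show ?thesis
        using mem_lcos_iff[OF L] that L by (simp add: subgroup.m_closed subgroup.m_inv_closed)
    qed
    show ?thesis using aux uz uzL by blast
  next
    case False
    then have cI: "c \<in> F - ?I" using c by blast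
    have "z \<notin> S c" using z cI by (auto simp: B_def)
    moreover have "u \<otimes> z \<notin> S c"
    proof
      assume *: "u \<otimes> z \<in> S c"
      have "z = inv u \<otimes> (u \<otimes> z)" using zc uc by (simp add: inv_mult_mult_cancel)
      then have "z \<in> inv u <# S c" using * by (auto simp: l_coset_def)
      then have "z \<in> \<Union>B" using cI by (auto simp: B_def)
      then show False using z by blast
    qed
    ultimately show ?thesis by blast
  qed
  then have "u \<otimes> z \<in> H" using det[OF zc, of "u \<otimes> z"] zc uc z by auto
  then have "(u \<otimes> z) \<otimes> inv z \<in> H" using z H by (simp add: subgroup.m_closed subgroup.m_inv_closed)
  then show "u \<in> H" using zc uc by (simp add: m_assoc)
qed

end

section \<open>Independent families of subgroups\<close>

text \<open>The subgroup \<open>N\<close> is explicit because dimensions are counted inside varying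
  subgroups of a power of the group. For a single index the condition says that the trace of
  \<open>K p\<close> on \<open>N\<close> has infinite index in \<open>N\<close>.\<close>

definition indep_family :: "('a, 'b) monoid_scheme \<Rightarrow> 'a set \<Rightarrow> ('i \<Rightarrow> 'a set) \<Rightarrow> 'i set \<Rightarrow> bool" where
  "indep_family G N K P \<longleftrightarrow> (\<forall>p\<in>P. \<not> virt_sub G (N \<inter> \<Inter>(K ` (P - {p}))) (K p))"

lemma indep_family_reindex:
  assumes "indep_family G N K P" "bij_betw f Q P"
  shows "indep_family G N (K \<circ> f) Q"
proof -
  have "(K \<circ> f) ` (Q - {q}) = K ` (P - {f q})" if "q \<in> Q" for q
    using assms(2) that inj_on_image_set_diff[of f Q Q "{q}"] by (auto simp: bij_betw_def image_comp[symmetric])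
  moreover have "f q \<in> P" if "q \<in> Q" for q
    using assms(2) that by (auto simp: bij_betw_def)
  ultimately show ?thesis
    using assms(1) by (simp add: indep_family_def)
qed

context group
begin

text \<open>\<open>J\<close> is a subset of least size whose intersection is virtually contained in
  all \<open>K p\<close>. If some p in \<open>J\<close> were redundant, the intersection over
  \<open>J - {p}\<close> would be virtually contained in the one over \<open>J\<close>, and by
  transitivity \<open>J - {p}\<close> would also do.\<close>

lemma indep_basis:
  assumes N: "subgroup N G" and P: "finite P" and K: "\<And>p. p \<in> P \<Longrightarrow> subgroup (K p) G"
  shows "\<exists>J\<subseteq>P. (\<forall>p\<in>P. virt_sub G (N \<inter> \<Inter>(K ` J)) (K p)) \<and> indep_family G N K J"
proof -
  define ok where "ok = (\<lambda>J. J \<subseteq> P \<and> (\<forall>p\<in>P. virt_sub G (N \<inter> \<Inter>(K ` J)) (K p)))"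
  have "ok P"
    unfolding ok_def using K by (auto intro!: virt_sub_subset)
  then obtain J where J: "ok J" and min: "\<And>J'. ok J' \<Longrightarrow> card J \<le> card J'"
    using ex_has_least_nat[of ok P card] by blast
  have JP: "J \<subseteq> P" and J': "\<And>p. p \<in> P \<Longrightarrow> virt_sub G (N \<inter> \<Inter>(K ` J)) (K p)"
    using J by (auto simp: ok_def)
  have "indep_family G N K J"
    unfolding indep_family_def
  proof (intro ballI notI)
    fix p assume p: "p \<in> J" and vs: "virt_sub G (N \<inter> \<Inter>(K ` (J - {p}))) (K p)"
    let ?H = "N \<inter> \<Inter>(K ` (J - {p}))"
    let ?H' = "N \<inter> \<Inter>(K ` J)"
    have H: "subgroup ?H G" and H': "subgroup ?H' G"
      by (rule subgroup_INT; use K JP N in blast)+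
    have Kp: "subgroup (K p) G" using K p JP by blast
    have "virt_sub G ?H (?H \<inter> K p)"
      by (rule virt_sub_Int[OF subgroup.subset[OF H] H Kp virt_sub_subset[OF H order_refl] vs])
    moreover have "?H \<inter> K p = ?H'" using p by blast
    ultimately have HH': "virt_sub G ?H ?H'" by simp
    have "virt_sub G ?H (K q)" if "q \<in> P" for q
      by (rule virt_sub_trans[OF subgroup.subset[OF H] H' K[OF that] HH' J'[OF that]])
    then have "ok (J - {p})" using JP by (auto simp: ok_def)
    then have "card J \<le> card (J - {p})" by (rule min)
    moreover have "finite J" using JP P by (rule finite_subset)
    ultimately show False using p by (metis card_Diff1_less not_less)
  qed
  then show ?thesis using JP J' by blast
qed

text \<open>With a basis \<open>J\<close> for the kernel of \<open>f\<close>, this splits an independent family of subgroups of \<open>N\<close>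
  into one in the kernel and one in the image.\<close>

lemma indep_family_image:
  assumes M: "group M" and f: "f \<in> hom G M" and N: "subgroup N G" 
    and K: "\<And>p. p \<in> P \<Longrightarrow> subgroup (K p) G" and ind: "indep_family G N K P" and J: "J \<subseteq> P"
    and ker: "\<And>p. p \<in> P \<Longrightarrow> virt_sub G ({x \<in> N. f x = \<one>\<^bsub>M\<^esub>} \<inter> \<Inter>(K ` J)) (K p)"
  shows "indep_family M (carrier M) (\<lambda>p. f ` (N \<inter> \<Inter>(K ` J) \<inter> K p)) (P - J)"
  unfolding indep_family_def
proof (intro ballI notI)
  interpret M: group M by fact
  interpret f: group_hom G M f
    using M f by (simp add: group_hom_def group_hom_axioms_def is_group)
  let ?W = "\<lambda>p. N \<inter> \<Inter>(K ` J) \<inter> K p"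
  let ?Q = "{x \<in> N. f x = \<one>\<^bsub>M\<^esub>} \<inter> \<Inter>(K ` J)"
  fix p assume p: "p \<in> P - J" 
    and vs: "virt_sub M (carrier M \<inter> \<Inter>((\<lambda>p. f ` ?W p) ` (P - J - {p}))) (f ` ?W p)"
  have Kp: "subgroup (K p) G" using K p by blast
  have NJ: "subgroup (N \<inter> \<Inter>(K ` J)) G" by (rule subgroup_INT) (use K J N in auto)
  have W: "subgroup (?W p) G" by (rule subgroups_Inter_pair[OF NJ Kp])
  let ?Y = "N \<inter> \<Inter>(K ` (P - {p}))"
  have Y: "subgroup ?Y G" by (rule subgroup_INT) (use K N in auto)
  have fW: "subgroup (f ` ?W p) M" by (rule f.subgroup_img_is_subgroup[OF W])
  let ?V = "{x \<in> carrier G. f x \<in> f ` ?W p}"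
  have V: "subgroup ?V G" by (rule subgroup_vimage[OF M f fW])
  have Yc: "?Y \<subseteq> carrier G" by (rule subgroup.subset[OF Y])
  \<comment> \<open>As p is not in \<open>J\<close>, \<open>?Y\<close> is contained in every
    \<open>?W q\<close> with q in \<open>P - J\<close> different from p.\<close>
  have "f ` ?Y \<subseteq> carrier M \<inter> \<Inter>((\<lambda>p. f ` ?W p) ` (P - J - {p}))"
    using Yc J p by (auto intro!: imageI)
  then have "virt_sub M (f ` ?Y) (f ` ?W p)" by (rule virt_sub_mono_left[OF vs])
  then have "virt_sub G ?Y ?V" by (rule virt_sub_vimage[OF M f Yc fW])
  then have "virt_sub G ?Y (?Y \<inter> ?V)"
    by (rule virt_sub_Int[OF Yc Y V virt_sub_subset[OF Y order_refl]])
  moreover have "virt_sub G (?Y \<inter> ?V) (K p)"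
  proof -
    have "(\<lambda>h. h <# K p) ` (?Y \<inter> ?V) \<subseteq> (\<lambda>h. h <# K p) ` ?Q"
    proof
      fix c assume "c \<in> (\<lambda>h. h <# K p) ` (?Y \<inter> ?V)"
      then obtain y w where y: "y \<in> ?Y" "c = y <# K p" and w: "w \<in> ?W p" "f y = f w" by blast
      have yJ: "y \<in> N \<inter> \<Inter>(K ` J)" using y J p by blast
      have wJ: "w \<in> N \<inter> \<Inter>(K ` J)" using w by blast
      have yc: "y \<in> carrier G" and wc: "w \<in> carrier G"
        using subgroup.mem_carrier[OF NJ] yJ wJ by auto
      \<comment> \<open>y and w have the same image, so y w^-1 is in the kernel. It represents the
        coset y K_p because w is in \<open>K p\<close>; thus the cosets of \<open>K p\<close> met
        here are already met by \<open>?Q\<close>.\<close>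
      have "y \<otimes> inv w \<in> N \<inter> \<Inter>(K ` J)"
        by (rule subgroup.m_closed[OF NJ yJ subgroup.m_inv_closed[OF NJ wJ]])
      moreover have "f (y \<otimes> inv w) = \<one>\<^bsub>M\<^esub>" using yc wc w by simp
      ultimately have q: "y \<otimes> inv w \<in> ?Q" by blast
      have eq: "(y \<otimes> inv w) <# K p = y <# K p"
      proof -
        have "inv (y \<otimes> inv w) \<otimes> y = w"
          using yc wc by (simp add: inv_mult_group m_assoc)
        then show ?thesis using lcos_eq_iff[OF Kp, of "y \<otimes> inv w" y] yc wc w by simp
      qed
      show "c \<in> (\<lambda>h. h <# K p) ` ?Q"
        using imageI[OF q, of "\<lambda>h. h <# K p"] unfolding y(2) eq .
    qed
    then show ?thesis
      using ker[of p] p unfolding virt_sub_def by (auto intro: finite_subset)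
  qed
  ultimately have "virt_sub G ?Y (K p)"
    using virt_sub_trans[OF Yc subgroups_Inter_pair[OF Y V] Kp] by blast
  then show False using ind p by (auto simp: indep_family_def)
qed

text \<open>The path \<open>\<sigma>\<close> is realised by the product of the elements \<open>h i (\<sigma> i)\<close>, which are chosen in an
  abelian subgroup of finite index.\<close>

lemma indep_family_array:
  fixes K :: "nat \<Rightarrow> 'a set"
  assumes K: "\<And>i. i < d \<Longrightarrow> subgroup (K i) G" and ind: "indep_family G (carrier G) K {..<d}"
    and Z: "subgroup Z G" "virt_sub G (carrier G) Z" "\<And>x y. x \<in> Z \<Longrightarrow> y \<in> Z \<Longrightarrow> x \<otimes> y = y \<otimes> x"
  obtains h where "\<And>i t. i < d \<Longrightarrow> h i t \<in> carrier G"
    "\<And>\<sigma> :: nat \<Rightarrow> nat. \<exists>y\<in>carrier G. \<forall>i<d. \<forall>t. y \<in> h i t <# K i \<longleftrightarrow> t = \<sigma> i"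
proof -
  let ?A = "\<lambda>i. carrier G \<inter> \<Inter>(K ` ({..<d} - {i}))"
  have A: "subgroup (?A i) G" for i by (rule subgroup_INT) (use K subgroup_self in auto)
  have AZ: "subgroup (?A i \<inter> Z) G" for i by (rule subgroups_Inter_pair[OF A Z(1)])
  have "\<exists>f :: nat \<Rightarrow> 'a. (\<forall>t. f t \<in> ?A i \<inter> Z) \<and> inj (\<lambda>t. f t <# K i)" if i: "i < d" for i
  proof -
    \<comment> \<open>Passing to the finite-index subgroup \<open>Z\<close> preserves independence:
      \<open>?A i \<inter> Z\<close> still meets infinitely many cosets of
      \<open>K i\<close>.\<close>
    have "virt_sub G (?A i) (?A i \<inter> Z)"
      by (intro virt_sub_Int virt_sub_subset A Z(1) order_refl virt_sub_mono_left[OF Z(2)]) auto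
    then have "\<not> virt_sub G (?A i \<inter> Z) (K i)"
      using virt_sub_trans[OF subgroup.subset[OF A] AZ K[OF i]] ind i
      unfolding indep_family_def by blast
    then obtain g :: "nat \<Rightarrow> 'a set" where g: "inj g" "range g \<subseteq> (\<lambda>h. h <# K i) ` (?A i \<inter> Z)"
      unfolding virt_sub_def using infinite_countable_subset by blast
    have "\<exists>x\<in>?A i \<inter> Z. g t = x <# K i" for t
      using subsetD[OF g(2) rangeI[of g t]] by (rule imageE) (rule bexI)
    then obtain f where f: "\<And>t. f t \<in> ?A i \<inter> Z" "\<And>t. g t = f t <# K i" by metis
    then have "(\<lambda>t. f t <# K i) = g" by auto
    then show ?thesis using f g by auto
  qed
  then obtain h :: "nat \<Rightarrow> nat \<Rightarrow> 'a" where h: "\<And>i t. i < d \<Longrightarrow> h i t \<in> ?A i \<inter> Z"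
      "\<And>i. i < d \<Longrightarrow> inj (\<lambda>t. h i t <# K i)" by metis
  have hc: "h i t \<in> carrier G" if "i < d" for i t using h(1)[OF that] by blast
  have "\<exists>y\<in>carrier G. \<forall>i<d. \<forall>t. y \<in> h i t <# K i \<longleftrightarrow> t = \<sigma> i" for \<sigma> :: "nat \<Rightarrow> nat"
  proof -
    \<comment> \<open>Induction on the number s of factors used so far. The next factor lies in
      \<open>K i\<close> for all i other than s, so it leaves the other cosets unchanged.\<close>
    have "\<exists>y\<in>Z. \<forall>i<d. if i < s then y \<in> h i (\<sigma> i) <# K i else y \<in> K i" if "s \<le> d" for s
      using that
    proof (induction s)
      case 0
      then show ?case
        by (intro bexI[of _ \<one>]) (use K Z(1) in \<open>auto simp: subgroup.one_closed\<close>)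
    next
      case (Suc s)
      then obtain y where y: "y \<in> Z" "\<And>i. i < d \<Longrightarrow> if i < s then y \<in> h i (\<sigma> i) <# K i else y \<in> K i"
        by auto
      have s: "s < d" using Suc.prems by simp
      let ?g = "h s (\<sigma> s)"
      have g: "?g \<in> ?A s" "?g \<in> Z" "?g \<in> carrier G" using h(1)[OF s] by auto
      have yc: "y \<in> carrier G" using y Z(1) subgroup.mem_carrier by fastforce
      have "if i < Suc s then y \<otimes> ?g \<in> h i (\<sigma> i) <# K i else y \<otimes> ?g \<in> K i" if i: "i < d" for i
      proof (cases "i = s")
        case True
        \<comment> \<open>Right multiplication by \<open>?g\<close> yields a point of the left coset
          of \<open>?g\<close> only after commuting the factors.\<close>
        have "y \<otimes> ?g = ?g \<otimes> y" using Z(3) y g by blast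
        then show ?thesis using True y(2)[OF s] mem_lcos_iff_mult[OF K[OF s] g(3) yc] by simp
      next
        case False
        then have gK: "?g \<in> K i" using g i by auto
        then have "y \<otimes> ?g \<in> h i (\<sigma> i) <# K i" if "y \<in> h i (\<sigma> i) <# K i"
          using that yc g mem_lcos_iff[OF K[OF i] hc[OF i]] K[OF i] hc[OF i]
          by (simp add: subgroup.m_closed flip: m_assoc)
        then show ?thesis
          using False y(2)[OF i] gK K[OF i] by (auto simp: subgroup.m_closed)
      qed
      moreover have "y \<otimes> ?g \<in> Z" using y g Z(1) by (simp add: subgroup.m_closed)
      ultimately show ?case by blast
    qed
    from this[of d] obtain y where y: "y \<in> Z" "\<And>i. i < d \<Longrightarrow> y \<in> h i (\<sigma> i) <# K i" by auto
    have yc: "y \<in> carrier G" using y Z(1) subgroup.mem_carrier by fastforce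
    have "y \<in> h i t <# K i \<longleftrightarrow> t = \<sigma> i" if i: "i < d" for i t
    proof
      assume "y \<in> h i t <# K i"
      then have "h i t <# K i = h i (\<sigma> i) <# K i"
        using lcos_eqI[OF K[OF i] hc[OF i]] y(2)[OF i] by metis
      then show "t = \<sigma> i" using h(2)[OF i] by (auto dest: injD)
    qed (use y i in auto)
    then show ?thesis using yc by blast
  qed
  then show thesis using that hc by blast
qed

end

section \<open>Definability with parameters\<close>

lemma val_cong: "(\<And>i. i \<in> fv_trm t \<Longrightarrow> e i = e' i) \<Longrightarrow> val M e t = val M e' t"
proof (induction t)
  case (App f ts)
  then have "map (val M e) ts = map (val M e') ts" by (intro map_cong) auto
  then show ?case by (simp only: val.simps)
qed simp

lemma sat_cong: "(\<And>i. i \<in> fv \<phi> \<Longrightarrow> e i = e' i) \<Longrightarrow> sat M e \<phi> \<longleftrightarrow> sat M e' \<phi>"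
proof (induction \<phi> arbitrary: e e')
  case (Eq s t)
  then show ?case using val_cong[of s e e' M] val_cong[of t e e' M] by simp
next
  case (Rel r ts)
  then have "map (val M e) ts = map (val M e') ts" by (intro map_cong val_cong) auto
  then show ?case by (simp only: sat.simps)
next
  case (Neg \<phi>)
  then show ?case by (metis fv.simps(3) sat.simps(3))
next
  case (Conj \<phi> \<psi>)
  then show ?case by (metis UnCI fv.simps(4) sat.simps(4))
next
  case (Ex i \<phi>)
  have "sat M (e(i := a)) \<phi> \<longleftrightarrow> sat M (e'(i := a)) \<phi>" for a
    by (rule Ex.IH) (use Ex.prems in auto)
  then show ?case by simp
qed

lemma finite_fv_trm: "finite (fv_trm t)"
  by (induction t) auto

lemma finite_fv: "finite (fv \<phi>)"
  by (induction \<phi>) (auto simp: finite_fv_trm)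

primrec subst_trm :: "(nat \<Rightarrow> nat) \<Rightarrow> 'f trm \<Rightarrow> 'f trm" where
  "subst_trm \<rho> (Var i) = Var (\<rho> i)"
| "subst_trm \<rho> (App f ts) = App f (map (subst_trm \<rho>) ts)"

text \<open>A bound variable is replaced by one beyond the images of all variables free in the body,
  which prevents capture. The renaming is the second argument because it changes below a
  quantifier.\<close>

primrec subst :: "('f, 'r) fm \<Rightarrow> (nat \<Rightarrow> nat) \<Rightarrow> ('f, 'r) fm" where
  "subst (Eq s t) = (\<lambda>\<rho>. Eq (subst_trm \<rho> s) (subst_trm \<rho> t))"
| "subst (Rel r ts) = (\<lambda>\<rho>. Rel r (map (subst_trm \<rho>) ts))"
| "subst (Neg \<phi>) = (\<lambda>\<rho>. Neg (subst \<phi> \<rho>))"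
| "subst (Conj \<phi> \<psi>) = (\<lambda>\<rho>. Conj (subst \<phi> \<rho>) (subst \<psi> \<rho>))"
| "subst (Ex i \<phi>) = (\<lambda>\<rho>. let j = Suc (Max (insert 0 (\<rho> ` fv \<phi>))) in Ex j (subst \<phi> (\<rho>(i := j))))"

lemma wf_subst_trm: "wf_trm L t \<Longrightarrow> wf_trm L (subst_trm \<rho> t)"
  by (induction t) (auto simp: list_all_iff)

lemma wf_subst: "wf_fm L \<phi> \<Longrightarrow> wf_fm L (subst \<phi> \<rho>)"
  by (induction \<phi> arbitrary: \<rho>) (auto simp: list_all_iff wf_subst_trm Let_def)

lemma fv_subst_trm: "fv_trm (subst_trm \<rho> t) = \<rho> ` fv_trm t"
  by (induction t) auto

lemma val_subst_trm: "val M e (subst_trm \<rho> t) = val M (e \<circ> \<rho>) t"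
proof (induction t)
  case (App f ts)
  then have "map (val M e) (map (subst_trm \<rho>) ts) = map (val M (e \<circ> \<rho>)) ts"
    by (simp add: comp_def)
  then show ?case by (simp only: val.simps subst_trm.simps)
qed simp

lemma fv_subst: "fv (subst \<phi> \<rho>) \<subseteq> \<rho> ` fv \<phi>"
proof (induction \<phi> arbitrary: \<rho>)
  case (Ex i \<phi>)
  define j where "j = Suc (Max (insert 0 (\<rho> ` fv \<phi>)))"
  have "fv (subst \<phi> (\<rho>(i := j))) \<subseteq> (\<rho>(i := j)) ` fv \<phi>" by (rule Ex.IH)
  then have "fv (subst \<phi> (\<rho>(i := j))) - {j} \<subseteq> \<rho> ` (fv \<phi> - {i})" by (auto split: if_splits)
  then show ?case by (simp add: j_def[symmetric] Let_def)
next
  case (Conj \<phi> \<psi>)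
  then show ?case by (simp add: image_Un) blast
qed (auto simp: fv_subst_trm)

lemma sat_subst: "sat M e (subst \<phi> \<rho>) \<longleftrightarrow> sat M (e \<circ> \<rho>) \<phi>"
proof (induction \<phi> arbitrary: \<rho> e)
  case (Rel r ts)
  have "map (val M e) (map (subst_trm \<rho>) ts) = map (val M (e \<circ> \<rho>)) ts"
    unfolding map_map by (rule map_cong[OF refl]) (simp add: val_subst_trm comp_def)
  then show ?case by (simp only: sat.simps subst.simps)
next
  case (Ex i \<phi>)
  define j where "j = Suc (Max (insert 0 (\<rho> ` fv \<phi>)))"
  have j: "\<rho> k \<noteq> j" if "k \<in> fv \<phi>" for k
  proof -
    have "\<rho> k \<le> Max (insert 0 (\<rho> ` fv \<phi>))"
      by (rule Max_ge) (use that finite_fv in auto)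
    then show ?thesis by (simp add: j_def)
  qed
  have "sat M (e(j := a)) (subst \<phi> (\<rho>(i := j))) \<longleftrightarrow> sat M ((e \<circ> \<rho>)(i := a)) \<phi>" for a
    unfolding Ex.IH by (rule sat_cong) (use j in auto)
  then show ?case by (simp add: j_def[symmetric] Let_def del: comp_apply)
qed (auto simp: val_subst_trm)

lemma subst_formulas: "\<phi> \<in> formulas L \<Longrightarrow> subst \<phi> \<rho> \<in> formulas L"
  by (simp add: formulas_def wf_subst)

section \<open>Closure properties of definable sets\<close>

text \<open>Sets of valuations over an arbitrary set of variables: \<open>\<rho>\<close> sends a variable of the formula
  to a variable or to a parameter.\<close>

definition pdef :: "('f, 'r) lang \<Rightarrow> ('a, 'f, 'r) struct \<Rightarrow> ('w \<Rightarrow> 'a) set \<Rightarrow> bool" where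
  "pdef L M X \<longleftrightarrow> (\<exists>\<phi>\<in>formulas L. \<exists>\<rho>. X = {v. sat M (case_sum v id \<circ> \<rho>) \<phi>})"

lemma pdefI:
  assumes "\<phi> \<in> formulas L" "\<And>v. v \<in> X \<longleftrightarrow> sat M (case_sum v id \<circ> \<rho>) \<phi>"
  shows "pdef L M X"
proof -
  have "X = {v. sat M (case_sum v id \<circ> \<rho>) \<phi>}" using assms(2) by blast
  then show ?thesis unfolding pdef_def using assms(1) by blast
qed

lemma pdefD:
  assumes "pdef L M X"
  shows "\<exists>\<phi> \<rho>. \<phi> \<in> formulas L \<and> (\<forall>v. v \<in> X \<longleftrightarrow> sat M (case_sum v id \<circ> \<rho>) \<phi>)"
  using assms unfolding pdef_def by auto

lemma pdef_compl:
  assumes "pdef L M X" shows "pdef L M (- X)"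
proof -
  obtain \<phi> \<rho> where \<phi>: "\<phi> \<in> formulas L" "\<And>v. v \<in> X \<longleftrightarrow> sat M (case_sum v id \<circ> \<rho>) \<phi>"
    using pdefD[OF assms] by blast
  show ?thesis
    by (rule pdefI[of "Neg \<phi>" _ _ _ \<rho>]) (use \<phi> in \<open>auto simp: formulas_def\<close>)
qed

lemma pdef_Int:
  assumes "pdef L M X" "pdef L M Y" shows "pdef L M (X \<inter> Y)"
proof -
  obtain \<phi> \<rho> where \<phi>: "\<phi> \<in> formulas L" "\<And>v. v \<in> X \<longleftrightarrow> sat M (case_sum v id \<circ> \<rho>) \<phi>"
    using pdefD[OF assms(1)] by blast
  obtain \<psi> \<tau> where \<psi>: "\<psi> \<in> formulas L" "\<And>v. v \<in> Y \<longleftrightarrow> sat M (case_sum v id \<circ> \<tau>) \<psi>"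
    using pdefD[OF assms(2)] by blast
  \<comment> \<open>Even variables carry the assignment of the first formula and odd ones that of
    the second, so the two cannot clash.\<close>
  define \<sigma> where "\<sigma> = (\<lambda>i. if even i then \<rho> (i div 2) else \<tau> (i div 2))"
  have "\<sigma> \<circ> (\<lambda>i. 2 * i) = \<rho>" "\<sigma> \<circ> (\<lambda>i. 2 * i + 1) = \<tau>" by (auto simp: \<sigma>_def)
  then have "case_sum v id \<circ> \<sigma> \<circ> (\<lambda>i. 2 * i) = case_sum v id \<circ> \<rho>"
      "case_sum v id \<circ> \<sigma> \<circ> (\<lambda>i. 2 * i + 1) = case_sum v id \<circ> \<tau>" for v
    by (metis comp_assoc)+
  then show ?thesis
    by (intro pdefI[of "Conj (subst \<phi> (\<lambda>i. 2 * i)) (subst \<psi> (\<lambda>i. 2 * i + 1))" _ _ _ \<sigma>])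
      (use \<phi> \<psi> in \<open>auto simp: formulas_def wf_subst sat_subst\<close>)
qed

lemma pdef_UNIV: "pdef L M UNIV"
  by (rule pdefI[of "Eq (Var 0) (Var 0)" _ _ _ "\<lambda>_. Inr undefined"]) (auto simp: formulas_def)

lemma pdef_INT: "finite I \<Longrightarrow> (\<And>i. i \<in> I \<Longrightarrow> pdef L M (X i)) \<Longrightarrow> pdef L M (\<Inter>i\<in>I. X i)"
  by (induction I rule: finite_induct) (auto simp: pdef_UNIV intro: pdef_Int)

lemma pdef_UN: "finite I \<Longrightarrow> (\<And>i. i \<in> I \<Longrightarrow> pdef L M (X i)) \<Longrightarrow> pdef L M (\<Union>i\<in>I. X i)"
  using pdef_compl[OF pdef_INT[of I L M "\<lambda>i. - X i"]] by (simp add: pdef_compl)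

text \<open>Substitution of variables (\<open>Inl\<close>) and parameters (\<open>Inr\<close>) for
  the variables of \<open>X\<close>; fixing some coordinates of a definable set is the typical
  case.\<close>

lemma pdef_vimage:
  assumes "pdef L M X" shows "pdef L M {v. case_sum v id \<circ> f \<in> X}"
proof -
  obtain \<phi> \<rho> where \<phi>: "\<phi> \<in> formulas L" "\<And>v. v \<in> X \<longleftrightarrow> sat M (case_sum v id \<circ> \<rho>) \<phi>"
    using pdefD[OF assms] by blast
  have "case_sum (case_sum v id \<circ> f) id \<circ> \<rho> = case_sum v id \<circ> (case_sum f Inr \<circ> \<rho>)" for v
    by (auto split: sum.split)
  then show ?thesis
    by (intro pdefI[of \<phi> _ _ _ "case_sum f Inr \<circ> \<rho>"]) (use \<phi> in auto)
qed

lemma pdef_ex: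
  assumes "pdef L M X" shows "pdef L M {v. \<exists>a. v(j := a) \<in> X}"
proof -
  obtain \<phi> \<rho> where \<phi>: "\<phi> \<in> formulas L" "\<And>v. v \<in> X \<longleftrightarrow> sat M (case_sum v id \<circ> \<rho>) \<phi>"
    using pdefD[OF assms] by blast
  \<comment> \<open>All variables are shifted by one to free variable 0 for the quantifier. Whatever
    \<sigma> has at 0 is overwritten.\<close>
  define \<sigma> where "\<sigma> = case_nat (Inl j) \<rho>"
  have "(case_sum v id \<circ> \<sigma>)(0 := a) \<circ> (\<lambda>i. if \<rho> i = Inl j then 0 else Suc i)
      = case_sum (v(j := a)) id \<circ> \<rho>" for v a
    by (auto simp: \<sigma>_def fun_eq_iff split: sum.split)
  then show ?thesis
    by (intro pdefI[of "Ex 0 (subst \<phi> (\<lambda>i. if \<rho> i = Inl j then 0 else Suc i))" _ _ _ \<sigma>])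
      (use \<phi> in \<open>auto simp: formulas_def wf_subst sat_subst\<close>)
qed

lemma pdef_ex_finite:
  assumes "finite J" "pdef L M X" shows "pdef L M {v. \<exists>u. override_on v u J \<in> X}"
  using assms(1)
proof (induction J rule: finite_induct)
  case empty
  then show ?case using assms(2) by simp
next
  case (insert j J)
  have "(\<exists>u. override_on v u (insert j J) \<in> X) \<longleftrightarrow> (\<exists>a u. override_on (v(j := a)) u J \<in> X)" for v
  proof
    assume "\<exists>u. override_on v u (insert j J) \<in> X"
    then obtain u where u: "override_on v u (insert j J) \<in> X" ..
    have "override_on v u (insert j J) = override_on (v(j := u j)) u J"
      using insert.hyps by (auto simp: override_on_def fun_eq_iff)
    then show "\<exists>a u. override_on (v(j := a)) u J \<in> X" using u by metis
  next
    assume "\<exists>a u. override_on (v(j := a)) u J \<in> X"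
    then obtain a u where u: "override_on (v(j := a)) u J \<in> X" by blast
    have "override_on v (u(j := a)) (insert j J) = override_on (v(j := a)) u J"
      using insert.hyps by (auto simp: override_on_def fun_eq_iff)
    then show "\<exists>u. override_on v u (insert j J) \<in> X" using u by metis
  qed
  then show ?case using pdef_ex[OF insert.IH, of j] by simp
qed

text \<open>The parameters of a definable set become additional object variables.\<close>

lemma pdef_formula:
  assumes "pdef L M X"
  obtains k' c \<phi> where "k \<le> k'" "\<phi> \<in> formulas L" "fv \<phi> \<subseteq> {..<k' + m}"
    "\<And>a b. a \<in> tuples k \<Longrightarrow> b \<in> tuples m \<Longrightarrow>
      sat M (join k' (\<lambda>i. if i < k then a i else if i < k' then c i else undefined) b) \<phi> \<longleftrightarrow> join k a b \<in> X"
proof -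
  obtain \<phi> \<rho> where \<phi>: "\<phi> \<in> formulas L" "\<And>v. v \<in> X \<longleftrightarrow> sat M (case_sum v id \<circ> \<rho>) \<phi>"
    using pdefD[OF assms] by blast
  obtain N where N: "fv \<phi> \<subseteq> {..<N}"
    using finite_nat_iff_bounded finite_fv by metis
  define k' where "k' = k + N"
  \<comment> \<open>Variable i of the formula, if it stands for a parameter, moves to position
    \<open>k + i\<close>. A variable \<open>Inl j\<close> with j \<ge> k + m is treated the same
    way: \<open>join k a b\<close> has the value \<open>undefined\<close> there, which
    \<open>c\<close> supplies.\<close>
  define \<tau> where "\<tau> = (\<lambda>i. case \<rho> i of
      Inl j \<Rightarrow> if j < k then j else if j < k + m then k' + (j - k) else k + i | Inr a \<Rightarrow> k + i)"
  define c where "c = (\<lambda>i. case \<rho> (i - k) of Inl j \<Rightarrow> undefined | Inr a \<Rightarrow> a)"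
  have "fv (subst \<phi> \<tau>) \<subseteq> \<tau> ` fv \<phi>" by (rule fv_subst)
  also have "\<dots> \<subseteq> {..<k' + m}"
    using N by (auto simp: \<tau>_def k'_def split: sum.splits)
  finally have "fv (subst \<phi> \<tau>) \<subseteq> {..<k' + m}" .
  moreover have "sat M (join k' (\<lambda>i. if i < k then a i else if i < k' then c i else undefined) b) (subst \<phi> \<tau>) 
      \<longleftrightarrow> join k a b \<in> X" if "a \<in> tuples k" "b \<in> tuples m" for a b
    unfolding sat_subst \<phi>(2)
  proof (rule sat_cong)
    fix i assume "i \<in> fv \<phi>"
    then have i: "i < N" using N by auto
    have b: "b j = undefined" if "\<not> j < m" for j using that \<open>b \<in> tuples m\<close> by (auto simp: PiE_iff extensional_def)
    show "(join k' (\<lambda>i. if i < k then a i else if i < k' then c i else undefined) b \<circ> \<tau>) i =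
          (case_sum (join k a b) id \<circ> \<rho>) i"
      using i by (cases "\<rho> i") (auto simp: join_def \<tau>_def k'_def c_def intro!: b[symmetric])
  qed
  ultimately show thesis
    using that[of k' "subst \<phi> \<tau>" c] subst_formulas[OF \<phi>(1)] by (simp add: k'_def)
qed

abbreviation tdef :: "('f, 'r) lang \<Rightarrow> ('a, 'f, 'r) struct \<Rightarrow> nat \<Rightarrow> (nat \<Rightarrow> 'a) set \<Rightarrow> bool" where
  "tdef L M m X \<equiv> pdef L M {v :: nat \<Rightarrow> 'a. restrict v {..<m} \<in> X}"


section \<open>Elimination of imaginary variables\<close>

text \<open>A variable of sort \<open>Imag n E\<close> is represented by \<open>n\<close> variables of the home sort.\<close>

definition eq_val ::
  "('a, 'f, 'r) struct \<Rightarrow> ((('f, 'r) eqsort \<times> nat) \<times> nat \<Rightarrow> 'a) \<Rightarrow> ('f, 'r) eqsort \<times> nat \<Rightarrow> 'a eqelem" where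
  "eq_val M V p = (case fst p of Home \<Rightarrow> Pt (V (p, 0)) 
     | Imag n E \<Rightarrow> Cls (imag_rel M n E `` {\<lambda>t\<in>{..<n}. V (p, t)}))"

lemma imag_class_eq_iff:
  assumes "valid_sort L M (Imag n E)"
  shows "imag_rel M n E `` {restrict f {..<n}} = imag_rel M n E `` {restrict g {..<n}} \<longleftrightarrow>
    sat M (\<lambda>i. if i < n then f i else g (i - n)) E"
proof -
  have eq: "equiv (tuples n) (imag_rel M n E)" and fv: "fv E \<subseteq> {..<n + n}" using assms by auto
  have "imag_rel M n E `` {restrict f {..<n}} = imag_rel M n E `` {restrict g {..<n}} \<longleftrightarrow>
      (restrict f {..<n}, restrict g {..<n}) \<in> imag_rel M n E"
    by (rule eq_equiv_class_iff[OF eq]) auto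
  also have "\<dots> \<longleftrightarrow> sat M (join n (restrict f {..<n}) (restrict g {..<n})) E"
    by (auto simp: imag_rel_def)
  also have "\<dots> \<longleftrightarrow> sat M (\<lambda>i. if i < n then f i else g (i - n)) E"
    by (rule sat_cong) (use fv in \<open>auto simp: join_def\<close>)
  finally show ?thesis .
qed

text \<open>This turns a quantifier over a sort into quantifiers over the home variables that
  represent its elements.\<close>

lemma eq_val_range: "sort_dom M s = range (\<lambda>u. eq_val M u (s, i))"
proof (cases s)
  case Home
  have "a \<in> range (\<lambda>u. eq_val M u (s, i))" if "a \<in> range Pt" for a
    using that Home by (auto simp: eq_val_def)
  then show ?thesis using Home by (auto simp: eq_val_def)
next
  case (Imag n E)
  have "Cls c \<in> range (\<lambda>u. eq_val M u (s, i))" if c: "c \<in> tuples n // imag_rel M n E" for c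
  proof -
    obtain x where x: "x \<in> tuples n" "c = imag_rel M n E `` {x}"
      using c by (auto simp: quotient_def)
    then have "(\<lambda>t\<in>{..<n}. x t) = x" by simp
    then have "Cls c = eq_val M (\<lambda>(p, t). x t) (s, i)" using x Imag by (simp add: eq_val_def)
    then show ?thesis by blast
  qed
  moreover have "eq_val M u (s, i) \<in> sort_dom M s" for u
  proof -
    have "(\<lambda>t\<in>{..<n}. u ((s, i), t)) \<in> tuples n" by simp
    then show ?thesis using Imag by (simp add: eq_val_def quotientI)
  qed
  ultimately show ?thesis using Imag by auto
qed

lemma eq_val_cong:
  assumes "\<And>t. V (p, t) = V' (p, t)"
  shows "eq_val M V p = eq_val M V' p"
  unfolding eq_val_def assms ..

lemma eqsat_cong:
  assumes "wf_eqfm L M \<chi>" "\<And>p. p \<in> fv_eqfm \<chi> \<Longrightarrow> v p = v' p"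
  shows "eqsat M v \<chi> \<longleftrightarrow> eqsat M v' \<chi>"
  using assms
proof (induction \<chi> arbitrary: v v')
  case (QHome \<phi>)
  have "sat M (\<lambda>i. pt (v (Home, i))) \<phi> \<longleftrightarrow> sat M (\<lambda>i. pt (v' (Home, i))) \<phi>"
    by (rule sat_cong) (use QHome in auto)
  then show ?case by simp
next
  case (QProj n E js i)
  then have "v (Home, js ! t) = v' (Home, js ! t)" if "t < n" for t
    using that by auto
  then have "(\<lambda>t\<in>{..<n}. pt (v (Home, js ! t))) = (\<lambda>t\<in>{..<n}. pt (v' (Home, js ! t)))"
    by (intro restrict_ext) auto
  then show ?case using QProj.prems(2)[of "(Imag n E, i)"] by (simp only: eqsat.simps) simp
next
  case (QNeg \<chi>)
  have "eqsat M v \<chi> \<longleftrightarrow> eqsat M v' \<chi>"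
    by (rule QNeg.IH) (use QNeg.prems in auto)
  then show ?case by simp
next
  case (QConj \<chi> \<xi>)
  have "eqsat M v \<chi> \<longleftrightarrow> eqsat M v' \<chi>" "eqsat M v \<xi> \<longleftrightarrow> eqsat M v' \<xi>"
    by (rule QConj.IH; use QConj.prems in auto)+
  then show ?case by simp
next
  case (QEx s i \<chi>)
  have "eqsat M (v((s, i) := c)) \<chi> \<longleftrightarrow> eqsat M (v'((s, i) := c)) \<chi>" for c
    by (rule QEx.IH) (use QEx.prems in auto)
  then show ?case by simp
qed simp

text \<open>Equality of two classes is the formula \<open>E\<close> applied to representatives, and
  quantifying over a class amounts to quantifying over a representative tuple.\<close>

lemma pdef_eqfm: "wf_eqfm L M \<chi> \<Longrightarrow> pdef L M {V. eqsat M (eq_val M V) \<chi>}"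
proof (induction \<chi>)
  case (QHome \<phi>)
  then show ?case
    by (intro pdefI[of \<phi> _ _ _ "\<lambda>i. Inl ((Home, i), 0)"]) (auto simp: eq_val_def comp_def)
next
  case (QProj n E js i)
  have "eqsat M (eq_val M V) (QProj n E js i) \<longleftrightarrow> 
      sat M (\<lambda>j. if j < n then V ((Imag n E, i), j) else V ((Home, js ! (j - n)), 0)) E" for V
    using imag_class_eq_iff[of L M n E "\<lambda>t. V ((Imag n E, i), t)" "\<lambda>t. V ((Home, js ! t), 0)"] QProj
    by (simp add: eq_val_def)
  then show ?case
    using QProj by (intro pdefI[of E _ _ _ "\<lambda>j. Inl (if j < n then ((Imag n E, i), j) else ((Home, js ! (j - n)), 0))"])
      (auto simp: comp_def if_distrib cong: if_cong)
next
  case (QEq s i j)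
  show ?case
  proof (cases s)
    case Home
    then show ?thesis
      by (intro pdefI[of "Eq (Var 0) (Var 1)" _ _ _ "\<lambda>k. Inl ((s, if k = 0 then i else j), 0)"])
        (auto simp: eq_val_def formulas_def)
  next
    case (Imag n E)
    have "eqsat M (eq_val M V) (QEq s i j) \<longleftrightarrow> 
      sat M (\<lambda>k. if k < n then V ((s, i), k) else V ((s, j), k - n)) E" for V
      using imag_class_eq_iff[of L M n E "\<lambda>t. V ((s, i), t)" "\<lambda>t. V ((s, j), t)"] QEq Imag
      by (simp add: eq_val_def)
    then show ?thesis
      using QEq Imag by (intro pdefI[of E _ _ _ "\<lambda>k. Inl (if k < n then ((s, i), k) else ((s, j), k - n))"])
        (auto simp: comp_def if_distrib cong: if_cong)
  qed
next
  case (QNeg \<chi>)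
  then show ?case using pdef_compl[of L M "{V. eqsat M (eq_val M V) \<chi>}"] by (simp add: Collect_neg_eq)
next
  case (QConj \<chi> \<xi>)
  then show ?case
    using pdef_Int[of L M "{V. eqsat M (eq_val M V) \<chi>}" "{V. eqsat M (eq_val M V) \<xi>}"]
    by (simp add: Collect_conj_eq)
next
  case (QEx s i \<chi>)
  \<comment> \<open>The number of home variables representing a variable of sort
    \<open>s\<close>.\<close>
  define N where "N = (case s of Home \<Rightarrow> 1 | Imag n E \<Rightarrow> n)"
  let ?J = "{(s, i)} \<times> {..<N}"
  have eq: "eq_val M (override_on V u ?J) = (eq_val M V)((s, i) := eq_val M u (s, i))" for V u
  proof
    fix p
    show "eq_val M (override_on V u ?J) p = ((eq_val M V)((s, i) := eq_val M u (s, i))) p"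
    proof (cases "p = (s, i)")
      case True
      have "(\<lambda>t\<in>{..<n}. override_on V u ?J (p, t)) = (\<lambda>t\<in>{..<n}. u (p, t))" if "n = N" for n
        by (rule restrict_ext) (use True that in \<open>auto simp: override_on_def\<close>)
      then show ?thesis
        using True by (cases s) (auto simp: eq_val_def N_def)
    next
      case False
      then show ?thesis by (simp add: eq_val_cong[of "override_on V u ?J" p V])
    qed
  qed
  have "eqsat M (eq_val M V) (QEx s i \<chi>) \<longleftrightarrow> 
      (\<exists>u. override_on V u ?J \<in> {V. eqsat M (eq_val M V) \<chi>})" for V
    using eq_val_range[of M s i] by (simp add: eq)
  then show ?case
    using pdef_ex_finite[OF _ QEx.IH, of ?J] QEx.prems by simp
qed

lemma acl_eq_empty_sort_dom: "(s, c) \<in> acl_eq_empty L M \<Longrightarrow> c \<in> sort_dom M s"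
  by (auto simp: acl_eq_empty_def)

text \<open>Each imaginary parameter is an element of its sort, hence represented by a tuple of the
  home sort. Using these tuples as parameters gives a definition with home parameters only.\<close>

lemma acl_eq_empty_definable_tdef:
  assumes "acl_eq_empty_definable L M m X"
  shows "tdef L M m X"
proof -
  obtain \<chi> v where \<chi>: "wf_eqfm L M \<chi>"
    and v: "\<And>s i. (s, i) \<in> fv_eqfm \<chi> \<Longrightarrow> (s = Home \<and> i < m) \<or> (s, v (s, i)) \<in> acl_eq_empty L M"
    and X: "X = {x \<in> tuples m. eqsat M (\<lambda>(s, i). if s = Home \<and> i < m then Pt (x i) else v (s, i)) \<chi>}"
    using assms unfolding acl_eq_empty_definable_def by blast
  have "\<exists>u. v p \<in> sort_dom M (fst p) \<longrightarrow> eq_val M u p = v p" for p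
    using eq_val_range[of M "fst p" "snd p"] by auto
  then obtain U where U: "\<And>p. v p \<in> sort_dom M (fst p) \<Longrightarrow> eq_val M (U p) p = v p" by metis
  define f where "f = (\<lambda>(p, t). if fst p = Home \<and> snd p < m then Inl (snd p) else Inr (U p (p, t)))"
  have "restrict x {..<m} \<in> X \<longleftrightarrow> case_sum x id \<circ> f \<in> {V. eqsat M (eq_val M V) \<chi>}" for x
  proof -
    have "eqsat M (\<lambda>(s, i). if s = Home \<and> i < m then Pt (restrict x {..<m} i) else v (s, i)) \<chi> 
        \<longleftrightarrow> eqsat M (eq_val M (case_sum x id \<circ> f)) \<chi>"
    proof (rule eqsat_cong[OF \<chi>])
      fix p assume p: "p \<in> fv_eqfm \<chi>"
      obtain s i where si: "p = (s, i)" by (cases p)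
      show "(case p of (s, i) \<Rightarrow> if s = Home \<and> i < m then Pt (restrict x {..<m} i) else v (s, i))
          = eq_val M (case_sum x id \<circ> f) p"
      proof (cases "s = Home \<and> i < m")
        case True
        then show ?thesis by (simp add: si eq_val_def f_def)
      next
        case False
        then have "eq_val M (U p) p = v p"
          using v[of s i] p si acl_eq_empty_sort_dom[of s "v (s, i)"] U[of p] by auto
        moreover have "eq_val M (case_sum x id \<circ> f) p = eq_val M (U p) p"
          by (rule eq_val_cong) (use False si in \<open>auto simp: f_def\<close>)
        ultimately show ?thesis using False si by (simp add: case_prod_beta) auto
      qed
    qed
    then show ?thesis by (simp add: X)
  qed
  then show ?thesis using pdef_vimage[OF pdef_eqfm[OF \<chi>], of f] by simp
qed

section \<open>Definable sets of a one-based group\<close>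

text \<open>This replaces a normal form: the later arguments only compare points lying in the same
  members of a finite set of cosets.\<close>

lemma bool_combs_determined:
  assumes "X \<in> bool_combs U B"
  shows "\<exists>F. finite F \<and> F \<subseteq> B \<and>
    (\<forall>x\<in>U. \<forall>y\<in>U. (\<forall>c\<in>F. x \<in> c \<longleftrightarrow> y \<in> c) \<longrightarrow> (x \<in> X \<longleftrightarrow> y \<in> X))"
  using assms
proof induction
  case (basic X)
  then show ?case by (intro exI[of _ "{X}"]) auto
next
  case (compl X)
  then obtain F where F: "finite F" "F \<subseteq> B"
      "\<forall>x\<in>U. \<forall>y\<in>U. (\<forall>c\<in>F. x \<in> c \<longleftrightarrow> y \<in> c) \<longrightarrow> (x \<in> X \<longleftrightarrow> y \<in> X)" by auto
  show ?case
  proof (intro exI[of _ F] conjI ballI impI F(1,2))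
    fix x y assume "x \<in> U" "y \<in> U" "\<forall>c\<in>F. x \<in> c \<longleftrightarrow> y \<in> c"
    then have "x \<in> X \<longleftrightarrow> y \<in> X" using F(3) by blast
    then show "x \<in> U - X \<longleftrightarrow> y \<in> U - X" using \<open>x \<in> U\<close> \<open>y \<in> U\<close> by blast
  qed
next
  case (inter X Y)
  then obtain F F' where F: "finite F" "F \<subseteq> B"
      "\<forall>x\<in>U. \<forall>y\<in>U. (\<forall>c\<in>F. x \<in> c \<longleftrightarrow> y \<in> c) \<longrightarrow> (x \<in> X \<longleftrightarrow> y \<in> X)"
    and F': "finite F'" "F' \<subseteq> B"
      "\<forall>x\<in>U. \<forall>y\<in>U. (\<forall>c\<in>F'. x \<in> c \<longleftrightarrow> y \<in> c) \<longrightarrow> (x \<in> Y \<longleftrightarrow> y \<in> Y)" by auto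
  show ?case
  proof (intro exI[of _ "F \<union> F'"] conjI ballI impI)
    fix x y assume xy: "x \<in> U" "y \<in> U" and "\<forall>c\<in>F \<union> F'. x \<in> c \<longleftrightarrow> y \<in> c"
    then have *: "\<forall>c\<in>F. x \<in> c \<longleftrightarrow> y \<in> c" "\<forall>c\<in>F'. x \<in> c \<longleftrightarrow> y \<in> c" by blast+
    have "x \<in> X \<longleftrightarrow> y \<in> X" by (rule F(3)[THEN bspec, THEN bspec, THEN mp, OF xy *(1)])
    moreover have "x \<in> Y \<longleftrightarrow> y \<in> Y" by (rule F'(3)[THEN bspec, THEN bspec, THEN mp, OF xy *(2)])
    ultimately show "x \<in> X \<inter> Y \<longleftrightarrow> y \<in> X \<inter> Y" by blast
  qed (simp_all add: F F')
qed

locale one_based =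
  fixes L :: "('f, 'r) lang" and mul :: 'f and M :: "('a, 'f, 'r) struct"
  assumes one_based: "one_based_group L mul M"
begin

abbreviation A where "A \<equiv> str_group mul M"
abbreviation Pow_A where "Pow_A \<equiv> group_power mul M"

lemma group_A: "group A" and mul_fsym: "mul \<in> fsyms L" "farity L mul = 2"
  using one_based by (auto simp: one_based_group_def group_structure_def)

sublocale A: group A by (rule group_A)

lemma carrier_A [simp]: "carrier A = UNIV" and mult_A: "a \<otimes>\<^bsub>A\<^esub> b = fint M mul [a, b]"
  by (simp_all add: str_group_def)

sublocale Pow: group "Pow_A n" for n
  by (rule product_group) (rule group_A)

lemma inv_Pow: "x \<in> tuples n \<Longrightarrow> inv\<^bsub>Pow_A n\<^esub> x = (\<lambda>i\<in>{..<n}. inv\<^bsub>A\<^esub> x i)"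
  by (rule inv_product_group) (auto simp: group_A)

abbreviation e1 where "e1 k \<equiv> (\<lambda>i\<in>{..<k}. \<one>\<^bsub>A\<^esub>)"

lemma join_tuples: "b \<in> tuples m \<Longrightarrow> join k a b \<in> tuples (k + m)"
  by (auto simp: join_def PiE_iff extensional_def)

lemma join_hom: "join k (e1 k) \<in> hom (Pow_A m) (Pow_A (k + m))"
proof (rule homI)
  fix x y assume "x \<in> carrier (Pow_A m)" "y \<in> carrier (Pow_A m)"
  show "join k (e1 k) (x \<otimes>\<^bsub>Pow_A m\<^esub> y) = join k (e1 k) x \<otimes>\<^bsub>Pow_A (k + m)\<^esub> join k (e1 k) y"
    by (rule ext) (simp add: join_def less_diff_conv2)
qed (simp add: join_tuples)

text \<open>Two points over the same \<open>a\<close> differ by an element of 1 x A^m. This is why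
  the fibres of one coset over different \<open>a\<close> belong to one subgroup.\<close>

lemma join_diff:
  assumes "b \<in> tuples m" "b' \<in> tuples m" "a \<in> tuples k"
  shows "inv\<^bsub>Pow_A (k + m)\<^esub> (join k a b) \<otimes>\<^bsub>Pow_A (k + m)\<^esub> join k a b' = 
    join k (e1 k) (inv\<^bsub>Pow_A m\<^esub> b \<otimes>\<^bsub>Pow_A m\<^esub> b')"
  unfolding inv_Pow[OF join_tuples[OF assms(1)]] inv_Pow[OF assms(1)]
  by (auto simp: join_def fun_eq_iff restrict_def)

text \<open>Membership in \<open>X\<close> is decided by finitely many cosets of subgroups of
  A^(k+m), which form \<open>F\<close>. The fibre \<open>S c a\<close> of the coset \<open>c\<close>
  over \<open>a\<close> is empty or a coset of the subgroup of all b with (1, b) in the subgroup of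
  \<open>c\<close>.\<close>

lemma definable_fibres:
  assumes "definable_over L M UNIV (k + m) X"
  obtains F :: "(nat \<Rightarrow> 'a) set set" and H S where "finite F" 
    "\<And>c. c \<in> F \<Longrightarrow> subgroup (H c) (Pow_A m)" "\<And>c. c \<in> F \<Longrightarrow> tdef L M m (H c)"
    "\<And>c a b. c \<in> F \<Longrightarrow> a \<in> tuples k \<Longrightarrow> b \<in> S c a \<Longrightarrow> b \<in> tuples m \<and> S c a = b <#\<^bsub>Pow_A m\<^esub> H c"
    "\<And>a b b'. a \<in> tuples k \<Longrightarrow> b \<in> tuples m \<Longrightarrow> b' \<in> tuples m \<Longrightarrow> 
      (\<forall>c\<in>F. b \<in> S c a \<longleftrightarrow> b' \<in> S c a) \<Longrightarrow> join k a b \<in> X \<longleftrightarrow> join k a b' \<in> X"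
proof -
  let ?P = "Pow_A (k + m)"
  have "X \<in> bool_combs (tuples (k + m)) {g <#\<^bsub>?P\<^esub> H | g H.
             g \<in> tuples (k + m) \<and> subgroup H ?P \<and> acl_eq_empty_definable L M (k + m) H}"
    using one_based assms unfolding one_based_group_def by blast
  from bool_combs_determined[OF this] obtain F where F: "finite F" 
    and FB: "F \<subseteq> {g <#\<^bsub>?P\<^esub> H | g H. g \<in> tuples (k + m) \<and> subgroup H ?P \<and> acl_eq_empty_definable L M (k + m) H}"
    and det: "\<forall>x\<in>tuples (k + m). \<forall>y\<in>tuples (k + m). (\<forall>c\<in>F. x \<in> c \<longleftrightarrow> y \<in> c) \<longrightarrow> (x \<in> X \<longleftrightarrow> y \<in> X)"
    by blast
  have "\<forall>c\<in>F. \<exists>g H. c = g <#\<^bsub>?P\<^esub> H \<and> g \<in> tuples (k + m) \<and> subgroup H ?P \<and> acl_eq_empty_definable L M (k + m) H"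
    using FB by blast
  then obtain g H where gH: "\<And>c. c \<in> F \<Longrightarrow> c = g c <#\<^bsub>?P\<^esub> H c" "\<And>c. c \<in> F \<Longrightarrow> g c \<in> tuples (k + m)" 
      "\<And>c. c \<in> F \<Longrightarrow> subgroup (H c) ?P" "\<And>c. c \<in> F \<Longrightarrow> acl_eq_empty_definable L M (k + m) (H c)"
    by metis
  define H' where "H' = (\<lambda>c. {b \<in> tuples m. join k (e1 k) b \<in> H c})"
  define S where "S = (\<lambda>(c :: (nat \<Rightarrow> 'a) set) a. {b \<in> tuples m. join k a b \<in> c})"
  have H': "subgroup (H' c) (Pow_A m)" if "c \<in> F" for c
    using Pow.subgroup_vimage[OF Pow.group_axioms join_hom gH(3)[OF that]] by (simp add: H'_def)
  have td: "tdef L M m (H' c)" if c: "c \<in> F" for c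
  proof -
    have td: "tdef L M (k + m) (H c)" by (rule acl_eq_empty_definable_tdef[OF gH(4)[OF c]])
    have "restrict v {..<m} \<in> H' c \<longleftrightarrow> 
      restrict (case_sum v id \<circ> (\<lambda>i. if i < k then Inr \<one>\<^bsub>A\<^esub> else Inl (i - k))) {..<k + m} \<in> H c" for v
    proof -
      have "restrict (case_sum v id \<circ> (\<lambda>i. if i < k then Inr \<one>\<^bsub>A\<^esub> else Inl (i - k))) {..<k + m}
          = join k (e1 k) (restrict v {..<m})"
        by (auto simp: join_def fun_eq_iff restrict_def)
      then show ?thesis by (simp add: H'_def)
    qed
    then show ?thesis
      using pdef_vimage[OF td, of "\<lambda>i. if i < k then Inr \<one>\<^bsub>A\<^esub> else Inl (i - k)"] by simp
  qed
  have cos: "b \<in> tuples m \<and> S c a = b <#\<^bsub>Pow_A m\<^esub> H' c" 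
    if c: "c \<in> F" and a: "a \<in> tuples k" and b: "b \<in> S c a" for c a b
  proof
    show bt: "b \<in> tuples m" using b by (simp add: S_def)
    have jb: "join k a b \<in> carrier ?P" using join_tuples bt by simp
    have cb: "c = join k a b <#\<^bsub>?P\<^esub> H c"
      using Pow.lcos_eqI[OF gH(3)[OF c], of "g c" "join k a b"] b gH(1,2)[OF c] by (simp add: S_def)
    have "b' \<in> S c a \<longleftrightarrow> b' \<in> b <#\<^bsub>Pow_A m\<^esub> H' c" if b': "b' \<in> tuples m" for b'
    proof -
      have jb': "join k a b' \<in> carrier ?P" using join_tuples b' by simp
      have "b' \<in> S c a \<longleftrightarrow> join k a b' \<in> join k a b <#\<^bsub>?P\<^esub> H c"
        using cb b' by (simp add: S_def)
      also have "\<dots> \<longleftrightarrow> join k (e1 k) (inv\<^bsub>Pow_A m\<^esub> b \<otimes>\<^bsub>Pow_A m\<^esub> b') \<in> H c"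
        unfolding Pow.mem_lcos_iff[OF gH(3)[OF c] jb jb'] join_diff[OF bt b' a] ..
      also have "\<dots> \<longleftrightarrow> inv\<^bsub>Pow_A m\<^esub> b \<otimes>\<^bsub>Pow_A m\<^esub> b' \<in> H' c"
        using Pow.m_closed[OF Pow.inv_closed, of b m b'] bt b' by (simp add: H'_def del: mult_product_group)
      also have "\<dots> \<longleftrightarrow> b' \<in> b <#\<^bsub>Pow_A m\<^esub> H' c"
        using Pow.mem_lcos_iff[OF H'[OF c], of b b'] bt b' by simp
      finally show ?thesis .
    qed
    moreover have "b <#\<^bsub>Pow_A m\<^esub> H' c \<subseteq> tuples m"
      using Pow.lcos_carrier[OF H'[OF c], of b] bt by auto
    ultimately show "S c a = b <#\<^bsub>Pow_A m\<^esub> H' c" by (auto simp: S_def)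
  qed
  have dt: "join k a b \<in> X \<longleftrightarrow> join k a b' \<in> X" 
    if "a \<in> tuples k" "b \<in> tuples m" "b' \<in> tuples m" "\<forall>c\<in>F. b \<in> S c a \<longleftrightarrow> b' \<in> S c a" for a b b'
    by (rule det[THEN bspec, THEN bspec, THEN mp, OF join_tuples[OF that(2)] join_tuples[OF that(3)]])
      (use that in \<open>simp add: S_def\<close>)
  show thesis
    by (rule that[of F H' S]) (rule F H' td cos dt; assumption)+
qed


section \<open>An abelian subgroup of finite index\<close>

text \<open>The graphs of the inner automorphisms form a uniformly definable family of subgroups, so up to
  finite index there are only finitely many of them.\<close>

lemma abelian_finite_index:
  obtains Z where "subgroup Z A" "virt_sub A UNIV Z" "\<And>x y. x \<in> Z \<Longrightarrow> y \<in> Z \<Longrightarrow> x \<otimes>\<^bsub>A\<^esub> y = y \<otimes>\<^bsub>A\<^esub> x"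
proof -
  \<comment> \<open>Coordinate 0 is the parameter g, and the fibre over it consists of the pairs (x,
    g x g^-1), the graph of conjugation by g.\<close>
  define X where "X = {x \<in> tuples (1 + 2). x 2 \<otimes>\<^bsub>A\<^esub> x 0 = x 0 \<otimes>\<^bsub>A\<^esub> x 1}"
  define \<phi> :: "('f, 'r) fm" where "\<phi> = Eq (App mul [Var 2, Var 0]) (App mul [Var 0, Var 1])"
  have "definable_over L M UNIV (1 + 2) X"
    unfolding definable_over_def
  proof (intro bexI exI conjI)
    show "\<phi> \<in> formulas L" using mul_fsym by (simp add: \<phi>_def formulas_def)
    show "\<forall>i\<in>fv \<phi>. i < 1 + 2 \<or> undefined i \<in> UNIV" by simp
    show "X = {x \<in> tuples (1 + 2). sat M (\<lambda>i. if i < 1 + 2 then x i else undefined i) \<phi>}"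
      by (auto simp: X_def \<phi>_def mult_A)
  qed
  then obtain F :: "(nat \<Rightarrow> 'a) set set" and H S where F: "finite F" 
    and H: "\<And>c. c \<in> F \<Longrightarrow> subgroup (H c) (Pow_A 2)" "\<And>c. c \<in> F \<Longrightarrow> tdef L M 2 (H c)"
    and S: "\<And>c a b. c \<in> F \<Longrightarrow> a \<in> tuples 1 \<Longrightarrow> b \<in> S c a \<Longrightarrow> b \<in> tuples 2 \<and> S c a = b <#\<^bsub>Pow_A 2\<^esub> H c"
    and det: "\<And>a b b'. a \<in> tuples 1 \<Longrightarrow> b \<in> tuples 2 \<Longrightarrow> b' \<in> tuples 2 \<Longrightarrow> 
      (\<forall>c\<in>F. b \<in> S c a \<longleftrightarrow> b' \<in> S c a) \<Longrightarrow> join 1 a b \<in> X \<longleftrightarrow> join 1 a b' \<in> X"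
    by (rule definable_fibres) blast
  define f where "f = (\<lambda>g x. \<lambda>i\<in>{..<2::nat}. if i = 0 then x else g \<otimes>\<^bsub>A\<^esub> x \<otimes>\<^bsub>A\<^esub> inv\<^bsub>A\<^esub> g)"
  have f: "f g \<in> hom A (Pow_A 2)" for g
  proof (rule homI)
    show "f g x \<in> carrier (Pow_A 2)" for x by (simp add: f_def)
    show "f g (x \<otimes>\<^bsub>A\<^esub> y) = f g x \<otimes>\<^bsub>Pow_A 2\<^esub> f g y" for x y
      by (rule ext) (simp add: f_def A.m_assoc A.inv_mult_mult_cancel)
  qed
  define \<Gamma> where "\<Gamma> = (\<lambda>g. f g ` UNIV)"
  interpret f: group_hom A "Pow_A 2" "f g" for g
    by (simp add: group_hom_def group_hom_axioms_def f A.group_axioms Pow.group_axioms)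
  have \<Gamma>: "subgroup (\<Gamma> g) (Pow_A 2)" for g
    using f.subgroup_img_is_subgroup[OF A.subgroup_self, of g] by (simp add: \<Gamma>_def)
  have mem_\<Gamma>: "b \<in> \<Gamma> g \<longleftrightarrow> b 1 \<otimes>\<^bsub>A\<^esub> g = g \<otimes>\<^bsub>A\<^esub> b 0" if b: "b \<in> tuples 2" for b g
  proof
    assume "b \<in> \<Gamma> g"
    then obtain x where "b = f g x" by (auto simp: \<Gamma>_def)
    then show "b 1 \<otimes>\<^bsub>A\<^esub> g = g \<otimes>\<^bsub>A\<^esub> b 0" by (simp add: f_def A.m_assoc)
  next
    assume *: "b 1 \<otimes>\<^bsub>A\<^esub> g = g \<otimes>\<^bsub>A\<^esub> b 0"
    have "b 1 = g \<otimes>\<^bsub>A\<^esub> b 0 \<otimes>\<^bsub>A\<^esub> inv\<^bsub>A\<^esub> g"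
      by (simp add: *[symmetric] A.m_assoc)
    then have "b = f g (b 0)"
      using b by (auto simp: f_def fun_eq_iff restrict_def PiE_iff extensional_def less_2_cases_iff)
    then show "b \<in> \<Gamma> g" by (auto simp: \<Gamma>_def)
  qed
  define a where "a = (\<lambda>g. \<lambda>i\<in>{..<1::nat}. g :: 'a)"
  have a: "a g \<in> tuples 1" for g by (simp add: a_def)
  have join_X: "join 1 (a g) b \<in> X \<longleftrightarrow> b \<in> \<Gamma> g" if b: "b \<in> tuples 2" for b g
    unfolding mem_\<Gamma>[OF b] using join_tuples[OF b, of 1 "a g"] by (simp add: X_def a_def join_def)
  \<comment> \<open>By the lemma on subgroups determined by cosets, the graph of g contains the
    intersection of the subgroups indexed by \<open>I g\<close>, and \<open>I\<close> has finitely
    many values.\<close>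
  define I where "I = (\<lambda>g. {c \<in> F. virt_sub (Pow_A 2) (\<Gamma> g) (H c)})"
  have I: "tuples 2 \<inter> \<Inter>(H ` I g) \<subseteq> \<Gamma> g" for g
  proof -
    have "carrier (Pow_A 2) \<inter> \<Inter>(H ` I g) \<subseteq> \<Gamma> g"
      unfolding I_def
    proof (rule Pow.subgroup_determined_by_cosets[where S = "\<lambda>c. S c (a g)", OF \<Gamma> F H(1)])
      fix c x assume "c \<in> F" "x \<in> S c (a g)"
      then show "x \<in> carrier (Pow_A 2) \<and> S c (a g) = x <#\<^bsub>Pow_A 2\<^esub> H c" using S[OF _ a] by simp
    next
      fix x y assume "x \<in> carrier (Pow_A 2)" "y \<in> carrier (Pow_A 2)" "\<forall>c\<in>F. x \<in> S c (a g) \<longleftrightarrow> y \<in> S c (a g)"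
      then show "x \<in> \<Gamma> g \<longleftrightarrow> y \<in> \<Gamma> g" using det[OF a, of x y g] join_X by simp
    qed
    then show ?thesis by simp
  qed
  define r where "r = (\<lambda>J. SOME g. I g = J)"
  have r: "I (r (I g)) = I g" for g unfolding r_def by (rule someI[of _ g]) simp
  have fin_I: "finite (range I)"
    by (rule finite_subset[of _ "Pow F"]) (use F in \<open>auto simp: I_def\<close>)
  define Q where "Q = Sigma (range I) id"
  have "finite Q" unfolding Q_def using fin_I F by (intro finite_SigmaI) (auto simp: I_def)
  define T where "T = (\<lambda>(J, c). {x \<in> carrier A. f (r J) x \<in> H c})"
  \<comment> \<open>For x in \<open>N\<close> and every representative r, the pair (x, r x r^-1)
    lies in all \<open>H c\<close> with \<open>c\<close> in \<open>I r\<close>. Each such condition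
    has finite index because the graph of r is virtually contained in \<open>H c\<close>.\<close>
  define N where "N = UNIV \<inter> \<Inter>(T ` Q)"
  have T: "subgroup (T q) A" "virt_sub A UNIV (T q)" if q: "q \<in> Q" for q
  proof -
    obtain g c where gc: "q = (I g, c)" "c \<in> I g" using q by (auto simp: Q_def)
    have Hc: "subgroup (H c) (Pow_A 2)" using gc H by (simp add: I_def)
    show "subgroup (T q) A" 
      using A.subgroup_vimage[OF Pow.group_axioms f Hc] gc by (simp add: T_def)
    have "c \<in> I (r (I g))" using gc r by simp
    then have "virt_sub (Pow_A 2) (f (r (I g)) ` UNIV) (H c)" by (simp add: I_def \<Gamma>_def)
    then show "virt_sub A UNIV (T q)"
      using A.virt_sub_vimage[OF Pow.group_axioms f _ Hc] gc by (simp add: T_def)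
  qed
  have sub_UNIV: "subgroup UNIV A" using A.subgroup_self by simp
  have N: "subgroup N A" "virt_sub A UNIV N"
    unfolding N_def
    using A.subgroup_INT[OF T(1) sub_UNIV, of Q] A.virt_sub_INT[OF subset_UNIV sub_UNIV \<open>finite Q\<close> T] by auto
  \<comment> \<open>The pair (x, r x r^-1) lies in the graph of every g with the same value of
    \<open>I\<close> as r, so g and r act alike on \<open>N\<close> by conjugation.\<close>
  have conj: "r (I g) \<otimes>\<^bsub>A\<^esub> x \<otimes>\<^bsub>A\<^esub> inv\<^bsub>A\<^esub> r (I g) \<otimes>\<^bsub>A\<^esub> g = g \<otimes>\<^bsub>A\<^esub> x" if x: "x \<in> N" for g x
  proof -
    have "f (r (I g)) x \<in> H c" if "c \<in> I g" for c
      using x that by (auto simp: N_def Q_def T_def)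
    moreover have ft: "f (r (I g)) x \<in> tuples 2" by (simp add: f_def)
    ultimately have "f (r (I g)) x \<in> \<Gamma> g" using I by blast
    then show ?thesis unfolding mem_\<Gamma>[OF ft] by (simp add: f_def)
  qed
  define C where "C = {z. \<forall>x\<in>N. z \<otimes>\<^bsub>A\<^esub> x = x \<otimes>\<^bsub>A\<^esub> z}"
  have C: "subgroup C A"
  proof unfold_locales
    show "C \<subseteq> carrier A" by simp
    show "\<one>\<^bsub>A\<^esub> \<in> C" by (simp add: C_def)
    fix y z assume "y \<in> C" "z \<in> C"
    then show "y \<otimes>\<^bsub>A\<^esub> z \<in> C" unfolding C_def by (simp add: A.m_assoc) (simp flip: A.m_assoc)
  next
    fix z assume z: "z \<in> C"
    have "inv\<^bsub>A\<^esub> z \<otimes>\<^bsub>A\<^esub> x = x \<otimes>\<^bsub>A\<^esub> inv\<^bsub>A\<^esub> z" if x: "x \<in> N" for x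
    proof -
      have "z \<otimes>\<^bsub>A\<^esub> x = x \<otimes>\<^bsub>A\<^esub> z" using x z by (simp add: C_def)
      then have "inv\<^bsub>A\<^esub> z \<otimes>\<^bsub>A\<^esub> (z \<otimes>\<^bsub>A\<^esub> x) \<otimes>\<^bsub>A\<^esub> inv\<^bsub>A\<^esub> z = inv\<^bsub>A\<^esub> z \<otimes>\<^bsub>A\<^esub> (x \<otimes>\<^bsub>A\<^esub> z) \<otimes>\<^bsub>A\<^esub> inv\<^bsub>A\<^esub> z" by simp
      then show ?thesis by (simp add: A.m_assoc A.inv_mult_mult_cancel)
    qed
    then show "inv\<^bsub>A\<^esub> z \<in> C" by (simp add: C_def)
  qed
  have "virt_sub A UNIV C"
  proof -
    have "g <#\<^bsub>A\<^esub> C = r (I g) <#\<^bsub>A\<^esub> C" for g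
    proof -
      \<comment> \<open>Since g and its representative conjugate \<open>N\<close> in the same way,
        their quotient centralises \<open>N\<close>; so the representatives meet every coset of the
        centraliser.\<close>
      have "inv\<^bsub>A\<^esub> r (I g) \<otimes>\<^bsub>A\<^esub> g \<in> C"
        unfolding C_def
      proof clarify
        fix x assume x: "x \<in> N"
        have "inv\<^bsub>A\<^esub> r (I g) \<otimes>\<^bsub>A\<^esub> (g \<otimes>\<^bsub>A\<^esub> x) = x \<otimes>\<^bsub>A\<^esub> (inv\<^bsub>A\<^esub> r (I g) \<otimes>\<^bsub>A\<^esub> g)"
          unfolding conj[OF x, of g, symmetric] by (simp add: A.m_assoc A.inv_mult_mult_cancel)
        then show "inv\<^bsub>A\<^esub> r (I g) \<otimes>\<^bsub>A\<^esub> g \<otimes>\<^bsub>A\<^esub> x = x \<otimes>\<^bsub>A\<^esub> (inv\<^bsub>A\<^esub> r (I g) \<otimes>\<^bsub>A\<^esub> g)" by (simp add: A.m_assoc)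
      qed
      then show ?thesis using A.lcos_eq_iff[OF C, of "r (I g)" g] by simp
    qed
    then have "(\<lambda>g. g <#\<^bsub>A\<^esub> C) ` UNIV \<subseteq> (\<lambda>J. r J <#\<^bsub>A\<^esub> C) ` range I" by blast
    then show ?thesis unfolding virt_sub_def using fin_I by (meson finite_imageI finite_subset)
  qed
  show thesis
  proof (rule that[of "N \<inter> C"])
    show "subgroup (N \<inter> C) A" by (rule A.subgroups_Inter_pair[OF N(1) C])
    show "virt_sub A UNIV (N \<inter> C)" by (rule A.virt_sub_Int[OF _ N(1) C N(2) \<open>virt_sub A UNIV C\<close>]) simp
    fix x y assume "x \<in> N \<inter> C" "y \<in> N \<inter> C"
    then show "x \<otimes>\<^bsub>A\<^esub> y = y \<otimes>\<^bsub>A\<^esub> x" unfolding C_def by blast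
  qed
qed

end

section \<open>Shatter functions\<close>

lemma shatter_fun_ge:
  assumes "B \<subseteq> X" "finite B"
  shows "card {C \<inter> B | C. C \<in> S} \<le> shatter_fun X S (card B)"
  unfolding shatter_fun_def
proof (rule cSup_upper)
  show "bdd_above {card {C \<inter> A |C. C \<in> S} |A. A \<subseteq> X \<and> finite A \<and> card A = card B}"
  proof (rule bdd_aboveI)
    fix x assume "x \<in> {card {C \<inter> A |C. C \<in> S} |A. A \<subseteq> X \<and> finite A \<and> card A = card B}"
    then obtain A where A: "x = card {C \<inter> A |C. C \<in> S}" "finite A" "card A = card B" by blast
    have "card {C \<inter> A |C. C \<in> S} \<le> card (Pow A)"
      by (rule card_mono) (use A in auto)
    then show "x \<le> 2 ^ card B" using A by (simp add: card_Pow)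
  qed
qed (use assms in blast)

lemma shatter_fun_le:
  assumes "\<And>B. B \<subseteq> X \<Longrightarrow> finite B \<Longrightarrow> card B = n \<Longrightarrow> card {C \<inter> B | C. C \<in> S} \<le> N"
  shows "shatter_fun X S n \<le> N"
proof (cases "{card {C \<inter> A |C. C \<in> S} |A. A \<subseteq> X \<and> finite A \<and> card A = n} = {}")
  case True
  then show ?thesis unfolding shatter_fun_def True by (simp add: Sup_nat_def)
next
  case False
  then show ?thesis unfolding shatter_fun_def by (rule cSup_least) (use assms in blast)
qed

lemma vc_le:
  assumes "\<And>n. n > 0 \<Longrightarrow> shatter_fun X S n \<le> N * n ^ D"
  shows "vc X S \<le> ereal (real D)"
  unfolding vc_def
proof (rule Inf_lower, intro CollectI exI conjI)
  show "(\<lambda>n. real (shatter_fun X S n)) \<in> O(\<lambda>n. real n powr real D)"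
  proof (rule bigoI[where c = "real N"])
    show "eventually (\<lambda>n. norm (real (shatter_fun X S n)) \<le> real N * norm (real n powr real D)) sequentially"
      using eventually_gt_at_top[of 0]
    proof eventually_elim
      case (elim n)
      have "real (shatter_fun X S n) \<le> real (N * n ^ D)" using assms[OF elim] by linarith
      then show ?case using elim by (simp add: powr_realpow)
    qed
  qed
qed simp_all

text \<open>If the shatter function is O(n^r), then n^D is O((D n)^r) = O(n^r), which forces D \<le>
  r. Multiples of \<open>D\<close> are used because the construction below places n points at each
  of \<open>D\<close> positions.\<close>

lemma vc_ge:
  assumes "\<And>n. n ^ D \<le> shatter_fun X S (D * n)"
  shows "ereal (real D) \<le> vc X S"
  unfolding vc_def
proof (rule Inf_greatest, clarify)
  fix r :: real assume r: "0 \<le> r" "(\<lambda>n. real (shatter_fun X S n)) \<in> O(\<lambda>n. real n powr r)"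
  show "ereal (real D) \<le> ereal r"
  proof (cases "D = 0")
    case False
    have "filterlim (\<lambda>n. D * n) at_top sequentially"
      using False by (intro mult_nat_left_at_top) simp
    from landau_o.big.compose[OF r(2) this]
    have "(\<lambda>n. real (shatter_fun X S (D * n))) \<in> O(\<lambda>n. real (D * n) powr r)" .
    moreover have "(\<lambda>n. real n powr real D) \<in> O(\<lambda>n. real (shatter_fun X S (D * n)))"
    proof (rule bigoI[where c = 1])
      show "eventually (\<lambda>n. norm (real n powr real D) \<le> 1 * norm (real (shatter_fun X S (D * n)))) sequentially"
        using eventually_gt_at_top[of 0]
      proof eventually_elim
        case (elim n)
        have "real (n ^ D) \<le> real (shatter_fun X S (D * n))" using assms[of n] by linarith
        then show ?case using elim by (simp add: powr_realpow)
      qed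
    qed
    moreover have "(\<lambda>n. real (D * n) powr r) \<in> O(\<lambda>n. real n powr r)"
      by (rule bigoI[where c = "real D powr r"]) (simp add: powr_mult)
    ultimately have "(\<lambda>n. real n powr real D) \<in> O(\<lambda>n. real n powr r)"
      by (blast intro: landau_o.big_trans)
    then have "real D \<le> r"
      by (subst (asm) powr_bigo_iff) (auto simp: filterlim_real_sequentially)
    then show ?thesis by simp
  qed (use r in simp)
qed


section \<open>Independent families of definable subgroups and vc-density\<close>

context one_based
begin

section \<open>Dimension count in powers of the group\<close>

abbreviation vdef where "vdef K \<equiv> pdef L M {v :: nat \<Rightarrow> 'a. v 0 \<in> K}"

definition indep_size :: "nat \<Rightarrow> bool" where
  "indep_size d \<longleftrightarrow> (\<exists>K :: nat \<Rightarrow> 'a set. (\<forall>i<d. subgroup (K i) A \<and> vdef (K i)) \<and> indep_family A UNIV K {..<d})"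

lemma vdef_proj:
  assumes W: "tdef L M m W" and Wm: "W \<subseteq> tuples m" and j: "j < m"
  shows "vdef ((\<lambda>y. y j) ` W)"
proof -
  \<comment> \<open>Variables 1 to m hold a tuple of \<open>W\<close>, to be quantified away;
    variable 0 holds its j-th coordinate.\<close>
  define Y where "Y = {v :: nat \<Rightarrow> 'a. restrict (\<lambda>i. v (Suc i)) {..<m} \<in> W} \<inter> {v. v (Suc j) = v 0}"
  have "pdef L M {v. restrict (\<lambda>i. v (Suc i)) {..<m} \<in> W}"
    using pdef_vimage[OF W, of "\<lambda>i. Inl (Suc i)"] by (simp add: comp_def)
  moreover have "pdef L M {v. v (Suc j) = v 0}"
    by (rule pdefI[of "Eq (Var 0) (Var 1)" _ _ _ "\<lambda>i. Inl (if i = 0 then Suc j else 0)"])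
      (auto simp: formulas_def)
  ultimately have "pdef L M Y" unfolding Y_def by (rule pdef_Int)
  then have "pdef L M {v. \<exists>u. override_on v u {1..m} \<in> Y}"
    by (rule pdef_ex_finite[rotated]) simp
  moreover have "(\<exists>u. override_on v u {1..m} \<in> Y) \<longleftrightarrow> v 0 \<in> (\<lambda>y. y j) ` W" for v
  proof
    assume "\<exists>u. override_on v u {1..m} \<in> Y"
    then obtain u where "override_on v u {1..m} \<in> Y" ..
    then have "restrict (\<lambda>i. u (Suc i)) {..<m} \<in> W" "u (Suc j) = v 0"
      using j by (auto simp: Y_def override_on_def restrict_def cong: if_cong)
    then show "v 0 \<in> (\<lambda>y. y j) ` W" using j by (intro image_eqI[of _ _ "restrict (\<lambda>i. u (Suc i)) {..<m}"]) auto
  next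
    assume "v 0 \<in> (\<lambda>y. y j) ` W"
    then obtain y where y: "y \<in> W" "v 0 = y j" by blast
    have "restrict (\<lambda>i. override_on v (\<lambda>i. y (i - 1)) {1..m} (Suc i)) {..<m} = y"
      using y Wm by (auto simp: fun_eq_iff restrict_def PiE_iff extensional_def override_on_def)
    then have "override_on v (\<lambda>i. y (i - 1)) {1..m} \<in> Y"
      using y j unfolding Y_def by (simp add: override_on_def)
    then show "\<exists>u. override_on v u {1..m} \<in> Y" by blast
  qed
  ultimately show ?thesis by simp
qed

lemma tdef_INT:
  assumes "finite P" "tdef L M m N" "\<And>p. p \<in> P \<Longrightarrow> tdef L M m (K p)"
  shows "tdef L M m (N \<inter> \<Inter>(K ` P))"
proof -
  have "{v. restrict v {..<m} \<in> N \<inter> \<Inter>(K ` P)} 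
      = {v. restrict v {..<m} \<in> N} \<inter> (\<Inter>p\<in>P. {v. restrict v {..<m} \<in> K p})" by blast
  moreover have "pdef L M (\<Inter>p\<in>P. {v. restrict v {..<m} \<in> K p})"
    by (rule pdef_INT) (use assms in auto)
  ultimately show ?thesis using pdef_Int[OF assms(2)] by simp
qed

text \<open>Induction on the number of free coordinates. The projection to coordinate j has as
  kernel the subgroup with one more trivial coordinate. A basis \<open>J\<close> there is bounded by
  induction, and the remaining indices yield an independent family of definable subgroups of
  \<open>A\<close>, of size at most d.\<close>

lemma indep_family_card_le:
  assumes d: "\<And>n. indep_size n \<Longrightarrow> n \<le> d" and j: "j \<le> m" and P: "finite P"
    and K: "\<And>p. p \<in> P \<Longrightarrow> subgroup (K p) (Pow_A m)" "\<And>p. p \<in> P \<Longrightarrow> tdef L M m (K p)"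
    and ind: "indep_family (Pow_A m) {y \<in> tuples m. \<forall>i<j. y i = \<one>\<^bsub>A\<^esub>} K P"
  shows "card P \<le> (m - j) * d"
  using j P K ind
proof (induction "m - j" arbitrary: j P)
  case 0
  have "P = {}"
  proof (rule ccontr)
    assume "P \<noteq> {}"
    then obtain p where p: "p \<in> P" by blast
    \<comment> \<open>Here j = m, and the trivial group meets only finitely many cosets, so every
      subgroup virtually contains it.\<close>
    have "{y \<in> tuples m. \<forall>i<j. y i = \<one>\<^bsub>A\<^esub>} \<subseteq> {e1 m}"
      using 0 by (auto simp: fun_eq_iff PiE_iff extensional_def)
    then have "finite ({y \<in> tuples m. \<forall>i<j. y i = \<one>\<^bsub>A\<^esub>} \<inter> \<Inter>(K ` (P - {p})))"
      by (meson finite.emptyI finite.insertI finite_Int finite_subset)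
    then have "virt_sub (Pow_A m) ({y \<in> tuples m. \<forall>i<j. y i = \<one>\<^bsub>A\<^esub>} \<inter> \<Inter>(K ` (P - {p}))) (K p)"
      unfolding virt_sub_def by (rule finite_imageI)
    then show False using 0 p unfolding indep_family_def by blast
  qed
  then show ?case by simp
next
  case (Suc n)
  have jm: "j < m" using Suc.hyps by simp
  define N where "N = (\<lambda>j. {y \<in> tuples m. \<forall>i<j. y i = \<one>\<^bsub>A\<^esub>})"
  have N: "subgroup (N i) (Pow_A m)" "tdef L M m (N i)" if i: "i \<le> m" for i
  proof -
    show "subgroup (N i) (Pow_A m)"
      by unfold_locales (use i in \<open>auto simp: N_def inv_Pow simp del: inv_product_group\<close>)
    have "pdef L M {v. v l = \<one>\<^bsub>A\<^esub>}" for l :: nat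
      by (rule pdefI[of "Eq (Var 0) (Var 1)" _ _ _ "\<lambda>i. if i = 0 then Inl l else Inr \<one>\<^bsub>A\<^esub>"])
        (auto simp: formulas_def)
    then have "pdef L M (\<Inter>l\<in>{..<i}. {v. v l = \<one>\<^bsub>A\<^esub>})" by (rule pdef_INT[OF finite_lessThan])
    moreover have "(\<Inter>l\<in>{..<i}. {v. v l = \<one>\<^bsub>A\<^esub>}) = {v. restrict v {..<m} \<in> N i}"
      using i by (auto simp: N_def)
    ultimately show "tdef L M m (N i)" by simp
  qed
  have \<pi>: "(\<lambda>y. y j) \<in> hom (Pow_A m) A" by (rule homI) (use jm in auto)
  have NS: "N (Suc j) = {x \<in> N j. x j = \<one>\<^bsub>A\<^esub>}" by (auto simp: N_def less_Suc_eq)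
  have "\<exists>J\<subseteq>P. (\<forall>p\<in>P. virt_sub (Pow_A m) (N (Suc j) \<inter> \<Inter>(K ` J)) (K p)) \<and>
      indep_family (Pow_A m) (N (Suc j)) K J"
    by (rule Pow.indep_basis[OF N(1)[OF Suc_leI[OF jm]] Suc.prems(2,3)])
  then obtain J where J: "J \<subseteq> P" "\<forall>p\<in>P. virt_sub (Pow_A m) (N (Suc j) \<inter> \<Inter>(K ` J)) (K p)"
      "indep_family (Pow_A m) (N (Suc j)) K J" by (elim exE conjE)
  have finJ: "finite J" using J(1) Suc.prems(2) by (rule finite_subset)
  have cJ: "card J \<le> (m - Suc j) * d"
    using Suc.hyps(1)[of "Suc j" J] Suc.hyps(2) jm finJ J(1,3) Suc.prems(3,4)
    by (simp add: N_def subset_iff)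
  let ?W = "\<lambda>p. N j \<inter> \<Inter>(K ` J) \<inter> K p"
  have "indep_family A (carrier A) (\<lambda>p. (\<lambda>y. y j) ` ?W p) (P - J)"
    by (rule Pow.indep_family_image[OF A.group_axioms \<pi> N(1) Suc.prems(3) _ J(1)])
      (use jm Suc.prems(5) J(2) NS in \<open>simp_all add: N_def\<close>)
  moreover obtain f where f: "bij_betw f {..<card (P - J)} (P - J)"
    using ex_bij_betw_nat_finite[of "P - J"] Suc.prems(2) by (auto simp: atLeast0LessThan)
  ultimately have "indep_family A UNIV ((\<lambda>p. (\<lambda>y. y j) ` ?W p) \<circ> f) {..<card (P - J)}"
    using indep_family_reindex by fastforce
  moreover have "subgroup ((\<lambda>y. y j) ` ?W p) A \<and> vdef ((\<lambda>y. y j) ` ?W p)" if p: "p \<in> P - J" for p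
  proof
    interpret \<pi>: group_hom "Pow_A m" A "\<lambda>y. y j"
      by (simp add: group_hom_def group_hom_axioms_def \<pi> A.group_axioms Pow.group_axioms)
    have W: "?W p = N j \<inter> \<Inter>(K ` insert p J)" by blast
    have sW: "subgroup (?W p) (Pow_A m)"
      unfolding W by (rule Pow.subgroup_INT) (use p J(1) Suc.prems(3) N(1) jm in auto)
    then show "subgroup ((\<lambda>y. y j) ` ?W p) A" by (rule \<pi>.subgroup_img_is_subgroup)
    have "tdef L M m (N j \<inter> \<Inter>(K ` insert p J))"
      by (rule tdef_INT) (use p J(1) Suc.prems(4) N(2) jm finJ in auto)
    then show "vdef ((\<lambda>y. y j) ` ?W p)"
      using vdef_proj[OF _ _ jm, of "?W p"] subgroup.subset[OF sW] unfolding W by simp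
  qed
  then have "\<forall>i<card (P - J). subgroup (((\<lambda>p. (\<lambda>y. y j) ` ?W p) \<circ> f) i) A \<and> 
      vdef (((\<lambda>p. (\<lambda>y. y j) ` ?W p) \<circ> f) i)"
    using bij_betwE[OF f] by simp
  ultimately have "indep_size (card (P - J))" unfolding indep_size_def by blast
  then have "card (P - J) \<le> d" by (rule d)
  moreover have "card P = card J + card (P - J)"
    using card_Diff_subset[OF finJ J(1)] card_mono[OF Suc.prems(2) J(1)] by simp
  moreover have "m - j = Suc (m - Suc j)" using jm by simp
  ultimately show ?case using cJ by simp
qed

end

section \<open>Upper bound for the vc-density\<close>

context one_based
begin

text \<open>The trace of a formula on \<open>B\<close> is determined by the cosets containing the parameter \<open>b\<close>. For
  those with index in \<open>I\<close>, it is enough to know the cosets of the subgroups in a basis \<open>J I\<close> and one of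
  finitely many cosets of \<open>\<Inter>(H ` I)\<close> in their intersection.\<close>

lemma card_traces_le:
  assumes D: "\<And>(J :: (nat \<Rightarrow> 'a) set set) H. finite J \<Longrightarrow> (\<And>c. c \<in> J \<Longrightarrow> subgroup (H c) (Pow_A m)) \<Longrightarrow>
      (\<And>c. c \<in> J \<Longrightarrow> tdef L M m (H c)) \<Longrightarrow> indep_family (Pow_A m) (tuples m) H J \<Longrightarrow> card J \<le> D"
    and \<phi>: "\<phi> \<in> formulas L" "fv \<phi> \<subseteq> {..<k + m}"
  shows "\<exists>N. \<forall>B. B \<subseteq> tuples k \<longrightarrow> finite B \<longrightarrow> B \<noteq> {} \<longrightarrow>
    card {C \<inter> B | C. C \<in> def_family M k m \<phi>} \<le> N * card B ^ D"
proof -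
  define X where "X = {x \<in> tuples (k + m). sat M x \<phi>}"
  let ?P = "Pow_A m"
  have "definable_over L M UNIV (k + m) X"
    unfolding definable_over_def
  proof (intro bexI[OF _ \<phi>(1)] exI conjI)
    have "sat M x \<phi> \<longleftrightarrow> sat M (\<lambda>i. if i < k + m then x i else undefined i) \<phi>" for x
      by (rule sat_cong) (use \<phi>(2) in auto)
    then show "X = {x \<in> tuples (k + m). sat M (\<lambda>i. if i < k + m then x i else undefined i) \<phi>}"
      by (simp add: X_def)
  qed simp
  then obtain F :: "(nat \<Rightarrow> 'a) set set" and H S where F: "finite F" 
    and H: "\<And>c. c \<in> F \<Longrightarrow> subgroup (H c) ?P" "\<And>c. c \<in> F \<Longrightarrow> tdef L M m (H c)"
    and S: "\<And>c a b. c \<in> F \<Longrightarrow> a \<in> tuples k \<Longrightarrow> b \<in> S c a \<Longrightarrow> b \<in> tuples m \<and> S c a = b <#\<^bsub>?P\<^esub> H c"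
    and det: "\<And>a b b'. a \<in> tuples k \<Longrightarrow> b \<in> tuples m \<Longrightarrow> b' \<in> tuples m \<Longrightarrow> 
      (\<forall>c\<in>F. b \<in> S c a \<longleftrightarrow> b' \<in> S c a) \<Longrightarrow> join k a b \<in> X \<longleftrightarrow> join k a b' \<in> X"
    by (rule definable_fibres) blast
  have sub: "subgroup (tuples m) ?P" using Pow.subgroup_self[of m] by simp
  have "\<exists>J\<subseteq>I. (\<forall>c\<in>I. virt_sub ?P (tuples m \<inter> \<Inter>(H ` J)) (H c)) \<and> indep_family ?P (tuples m) H J"
    if I: "I \<subseteq> F" for I
  proof -
    have "finite I" using I F by (rule finite_subset)
    moreover have "subgroup (H c) ?P" if "c \<in> I" for c using H I that by blast
    ultimately show ?thesis by (rule Pow.indep_basis[OF sub])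
  qed
  then obtain J where J: "\<And>I. I \<subseteq> F \<Longrightarrow> J I \<subseteq> I" 
      "\<And>I c. I \<subseteq> F \<Longrightarrow> c \<in> I \<Longrightarrow> virt_sub ?P (tuples m \<inter> \<Inter>(H ` J I)) (H c)"
      "\<And>I. I \<subseteq> F \<Longrightarrow> indep_family ?P (tuples m) H (J I)"
    by metis
  define LI where "LI = (\<lambda>I. tuples m \<inter> \<Inter>(H ` I))"
  define E where "E = (\<lambda>I. (\<lambda>h. h <#\<^bsub>?P\<^esub> LI I) ` LI (J I))"
  have LI: "subgroup (LI I) ?P" if I: "I \<subseteq> F" for I
    unfolding LI_def by (rule Pow.subgroup_INT[OF _ sub]) (use H I in auto)
  have finE: "finite (E I)" if I: "I \<subseteq> F" for I
  proof -
    \<comment> \<open>The intersection over the basis is virtually contained in each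
      \<open>H c\<close> with c in \<open>I\<close>, hence in their intersection.\<close>
    have "virt_sub ?P (LI (J I)) (LI I)"
      unfolding LI_def
      by (rule Pow.virt_sub_INT[OF _ sub finite_subset[OF I F]]) (use H J I in auto)
    then show ?thesis by (simp add: E_def virt_sub_def)
  qed
  have finJ: "finite (J I)" if I: "I \<subseteq> F" for I
    using J(1)[OF I] I F by (meson finite_subset)
  have cardJ: "card (J I) \<le> D" if I: "I \<subseteq> F" for I
    by (rule D[OF finJ[OF I] _ _ J(3)[OF I]]) (use H J(1)[OF I] I in auto)
  show ?thesis
  proof (intro exI allI impI)
    fix B :: "(nat \<Rightarrow> 'a) set" assume B: "B \<subseteq> tuples k" "finite B" "B \<noteq> {}"
    define tr where "tr = (\<lambda>b. {a\<in>B. join k a b \<in> X})"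
    define T where "T = (\<lambda>b. {(c, a). c \<in> F \<and> a \<in> B \<and> b \<in> S c a})"
    \<comment> \<open>A code consists of the set \<open>I\<close> of those c for which b lies in
      some \<open>S c a\<close>, a choice of such an a for each index in the basis, and a coset of
      \<open>LI I\<close>.\<close>
    define codes where "codes = Sigma (Pow F) (\<lambda>I. (J I \<rightarrow>\<^sub>E B) \<times> E I)"
    \<comment> \<open>A reference point chosen from the basis cosets alone. The parameter b is then
      located by the coset of \<open>LI I\<close> containing b0^-1 b.\<close>
    define b0 where "b0 = (\<lambda>I \<alpha>. SOME b. b \<in> tuples m \<and> (\<forall>j\<in>J I. b \<in> S j (\<alpha> j)))"
    define y where "y = (\<lambda>I \<alpha> e. SOME y. y \<in> tuples m \<and> inv\<^bsub>?P\<^esub> (b0 I \<alpha>) \<otimes>\<^bsub>?P\<^esub> y \<in> e)"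
    \<comment> \<open>The point \<open>y\<close> recovered from the code lies in the same cosets as
      b, hence determines \<open>T b\<close>. Any parameter b with this value of \<open>T\<close>
      has the same trace.\<close>
    define \<Psi> where "\<Psi> = (\<lambda>(I, \<alpha>, e). {a\<in>B. \<exists>b\<in>tuples m. 
        T b = {(c, a). c \<in> I \<and> a \<in> B \<and> y I \<alpha> e \<in> S c a} \<and> join k a b \<in> X})"
    have "tr ` tuples m \<subseteq> \<Psi> ` codes"
    proof (rule image_subsetI)
      fix b :: "nat \<Rightarrow> 'a" assume b: "b \<in> tuples m"
      define I where "I = {c\<in>F. \<exists>a\<in>B. b \<in> S c a}"
      have I: "I \<subseteq> F" by (auto simp: I_def)
      define \<alpha> where "\<alpha> = (\<lambda>j\<in>J I. SOME a. a \<in> B \<and> b \<in> S j a)"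
      have \<alpha>: "\<alpha> j \<in> B \<and> b \<in> S j (\<alpha> j)" if j: "j \<in> J I" for j
      proof -
        have "\<exists>a. a \<in> B \<and> b \<in> S j a" using j J(1)[OF I] by (auto simp: I_def)
        then show ?thesis using someI_ex[of "\<lambda>a. a \<in> B \<and> b \<in> S j a"] j by (simp add: \<alpha>_def)
      qed
      have b0: "b0 I \<alpha> \<in> tuples m \<and> (\<forall>j\<in>J I. b0 I \<alpha> \<in> S j (\<alpha> j))"
        unfolding b0_def by (rule someI[of _ b]) (use b \<alpha> in auto)
      then have b0c: "b0 I \<alpha> \<in> carrier ?P" by simp
      have bc: "b \<in> carrier ?P" using b by simp
      define h where "h = inv\<^bsub>?P\<^esub> (b0 I \<alpha>) \<otimes>\<^bsub>?P\<^esub> b"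
      have hc: "h \<in> carrier ?P" unfolding h_def using b0c bc by blast
      have "h \<in> H j" if j: "j \<in> J I" for j
      proof -
        have jF: "j \<in> F" using j J(1)[OF I] I by blast
        have "b0 I \<alpha> \<in> S j (\<alpha> j)" "\<alpha> j \<in> tuples k" using b0 j \<alpha>[OF j] B by auto
        then have "S j (\<alpha> j) = b0 I \<alpha> <#\<^bsub>?P\<^esub> H j" using S[OF jF] by blast
        then have "b \<in> b0 I \<alpha> <#\<^bsub>?P\<^esub> H j" using \<alpha>[OF j] by simp
        then show ?thesis unfolding h_def Pow.mem_lcos_iff[OF H(1)[OF jF] b0c bc] .
      qed
      then have hJ: "h \<in> LI (J I)" using hc by (simp add: LI_def)
      define e where "e = h <#\<^bsub>?P\<^esub> LI I"
      have eE: "e \<in> E I" using hJ by (auto simp: E_def e_def)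
      have "h \<in> e" unfolding e_def by (rule Pow.mem_lcos_self[OF LI[OF I] hc])
      then have "b \<in> tuples m \<and> inv\<^bsub>?P\<^esub> (b0 I \<alpha>) \<otimes>\<^bsub>?P\<^esub> b \<in> e"
        unfolding h_def by (rule conjI[OF b])
      then have y: "y I \<alpha> e \<in> tuples m \<and> inv\<^bsub>?P\<^esub> (b0 I \<alpha>) \<otimes>\<^bsub>?P\<^esub> y I \<alpha> e \<in> e"
        unfolding y_def by (rule someI[where P = "\<lambda>y. y \<in> tuples m \<and> inv\<^bsub>?P\<^esub> (b0 I \<alpha>) \<otimes>\<^bsub>?P\<^esub> y \<in> e"])
      then have yc: "y I \<alpha> e \<in> carrier ?P" by simp
      have "inv\<^bsub>?P\<^esub> h \<otimes>\<^bsub>?P\<^esub> (inv\<^bsub>?P\<^esub> (b0 I \<alpha>) \<otimes>\<^bsub>?P\<^esub> y I \<alpha> e) \<in> LI I"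
        using y Pow.mem_lcos_iff[OF LI[OF I] hc Pow.m_closed[OF Pow.inv_closed[OF b0c] yc]]
        unfolding e_def by blast
      moreover have "inv\<^bsub>?P\<^esub> h \<otimes>\<^bsub>?P\<^esub> (inv\<^bsub>?P\<^esub> (b0 I \<alpha>) \<otimes>\<^bsub>?P\<^esub> y I \<alpha> e) = inv\<^bsub>?P\<^esub> b \<otimes>\<^bsub>?P\<^esub> y I \<alpha> e"
        unfolding h_def Pow.inv_mult_group[OF Pow.inv_closed[OF b0c] bc] Pow.inv_inv[OF b0c]
          Pow.m_assoc[OF Pow.inv_closed[OF bc] b0c Pow.m_closed[OF Pow.inv_closed[OF b0c] yc]]
          Pow.mult_inv_mult_cancel[OF b0c yc] ..
      ultimately have by_LI: "inv\<^bsub>?P\<^esub> b \<otimes>\<^bsub>?P\<^esub> y I \<alpha> e \<in> LI I" by simp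
      have same: "b \<in> S c a \<longleftrightarrow> y I \<alpha> e \<in> S c a" if c: "c \<in> I" and a: "a \<in> B" for c a
      proof -
        have cF: "c \<in> F" using c I by blast
        have at: "a \<in> tuples k" using a B by blast
        have "inv\<^bsub>?P\<^esub> b \<otimes>\<^bsub>?P\<^esub> y I \<alpha> e \<in> H c" using by_LI c by (simp add: LI_def)
        then have eq: "b <#\<^bsub>?P\<^esub> H c = y I \<alpha> e <#\<^bsub>?P\<^esub> H c"
          using Pow.lcos_eq_iff[OF H(1)[OF cF] bc yc] by blast
        show ?thesis
        proof
          assume "b \<in> S c a"
          then show "y I \<alpha> e \<in> S c a"
            using S[OF cF at] Pow.mem_lcos_self[OF H(1)[OF cF] yc] eq by metis
        next
          assume "y I \<alpha> e \<in> S c a"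
          then show "b \<in> S c a"
            using S[OF cF at] Pow.mem_lcos_self[OF H(1)[OF cF] bc] eq by metis
        qed
      qed
      \<comment> \<open>No pair with first component outside \<open>I\<close> belongs to
        \<open>T b\<close>, by the choice of \<open>I\<close>; so it is enough that b and
        \<open>y\<close> agree on \<open>I\<close>.\<close>
      have Tb: "T b = {(c, a). c \<in> I \<and> a \<in> B \<and> y I \<alpha> e \<in> S c a}"
        using same I unfolding T_def I_def by blast
      have tr_eq: "join k a b' \<in> X \<longleftrightarrow> join k a b \<in> X" if "T b' = T b" "a \<in> B" "b' \<in> tuples m" for a b'
      proof (rule det)
        show "\<forall>c\<in>F. b' \<in> S c a \<longleftrightarrow> b \<in> S c a"
        proof
          fix c assume "c \<in> F"
          then show "b' \<in> S c a \<longleftrightarrow> b \<in> S c a"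
            using that(1,2) by (auto simp: T_def set_eq_iff)
        qed
      qed (use that b B in auto)
      have "tr b = \<Psi> (I, \<alpha>, e)"
        unfolding tr_def \<Psi>_def prod.case Tb[symmetric] using tr_eq b by blast
      moreover have "(I, \<alpha>, e) \<in> codes"
        using I \<alpha> eE by (auto simp: codes_def \<alpha>_def)
      ultimately show "tr b \<in> \<Psi> ` codes" by blast
    qed
    moreover have "finite codes"
      unfolding codes_def using F finE finJ B by (intro finite_SigmaI finite_cartesian_product finite_PiE) auto
    ultimately have "card (tr ` tuples m) \<le> card codes" by (meson card_image_le card_mono finite_imageI order_trans)
    also have "card codes = (\<Sum>I\<in>Pow F. card ((J I \<rightarrow>\<^sub>E B) \<times> E I))"
      unfolding codes_def using F finE finJ B
      by (intro card_SigmaI ballI finite_cartesian_product finite_PiE) auto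
    also have "\<dots> \<le> (\<Sum>I\<in>Pow F. card B ^ D * card (E I))"
    proof (rule sum_mono)
      fix I assume "I \<in> Pow F"
      then have I: "I \<subseteq> F" by blast
      \<comment> \<open>Raising the exponent from the size of the basis to \<open>D\<close> needs a
        nonempty \<open>B\<close>.\<close>
      have "card B > 0" using B by (simp add: card_gt_0_iff)
      then have "card B ^ card (J I) \<le> card B ^ D" using cardJ[OF I] by (intro power_increasing) auto
      then show "card ((J I \<rightarrow>\<^sub>E B) \<times> E I) \<le> card B ^ D * card (E I)"
        using finJ[OF I] by (simp add: card_cartesian_product card_PiE)
    qed
    also have "\<dots> = (\<Sum>I\<in>Pow F. card (E I)) * card B ^ D" by (simp add: sum_distrib_left mult.commute)
    finally have "card (tr ` tuples m) \<le> (\<Sum>I\<in>Pow F. card (E I)) * card B ^ D" .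
    moreover have "{C \<inter> B | C. C \<in> def_family M k m \<phi>} = tr ` tuples m"
    proof -
      have "{a \<in> tuples k. sat M (join k a b) \<phi>} \<inter> B = tr b" if "b \<in> tuples m" for b
        using B join_tuples[OF that] by (auto simp: tr_def X_def)
      then show ?thesis unfolding def_family_def by (auto simp: image_iff)
    qed
    ultimately show "card {C \<inter> B | C. C \<in> def_family M k m \<phi>} \<le> (\<Sum>I\<in>Pow F. card (E I)) * card B ^ D"
      by simp
  qed
qed

lemma vc_density_le:
  assumes d: "\<And>n. indep_size n \<Longrightarrow> n \<le> d"
  shows "vc_density L M m \<le> ereal (real (m * d))"
  unfolding vc_density_def
proof (rule Sup_least, clarify)
  fix k and \<phi> :: "('f, 'r) fm" assume \<phi>: "\<phi> \<in> formulas L" "fv \<phi> \<subseteq> {..<k + m}"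
  have *: "card J \<le> m * d" if "finite J" "\<And>c. c \<in> J \<Longrightarrow> subgroup (H c) (Pow_A m)"
      "\<And>c. c \<in> J \<Longrightarrow> tdef L M m (H c)" "indep_family (Pow_A m) (tuples m) H J" 
    for J :: "(nat \<Rightarrow> 'a) set set" and H
    using indep_family_card_le[OF d, of 0 m J H] that by simp
  have "\<exists>N. \<forall>B. B \<subseteq> tuples k \<longrightarrow> finite B \<longrightarrow> B \<noteq> {} \<longrightarrow>
    card {C \<inter> B | C. C \<in> def_family M k m \<phi>} \<le> N * card B ^ (m * d)"
    by (rule card_traces_le[OF _ \<phi>]) (rule *)
  then obtain N where N: "\<forall>B. B \<subseteq> tuples k \<longrightarrow> finite B \<longrightarrow> B \<noteq> {} \<longrightarrow>
    card {C \<inter> B | C. C \<in> def_family M k m \<phi>} \<le> N * card B ^ (m * d)" by (elim exE)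
  show "vc (tuples k) (def_family M k m \<phi>) \<le> ereal (real (m * d))"
  proof (rule vc_le, rule shatter_fun_le)
    fix n and B :: "(nat \<Rightarrow> 'a) set" assume *: "n > 0" "B \<subseteq> tuples k" "finite B" "card B = n"
    then have "B \<noteq> {}" by auto
    then show "card {C \<inter> B | C. C \<in> def_family M k m \<phi>} \<le> N * n ^ (m * d)" 
      using N[rule_format, of B] * by simp
  qed
qed

section \<open>Lower bound for the vc-density\<close>

lemma pdef_lcos:
  assumes K: "subgroup K A" "vdef K"
  shows "pdef L M {v :: nat \<Rightarrow> 'a. v q \<in> v p <#\<^bsub>A\<^esub> K}"
proof -
  \<comment> \<open>A variable different from p and q, used for the element of \<open>K\<close> by
    which they differ.\<close>
  define n where "n = Suc (p + q)"
  have "pdef L M {v. v n \<in> K}"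
    using pdef_vimage[OF K(2), of "\<lambda>_. Inl n"] by (simp add: comp_def)
  moreover have "pdef L M {v. v q = v p \<otimes>\<^bsub>A\<^esub> v n}"
    by (rule pdefI[of "Eq (Var 0) (App mul [Var 1, Var 2])" _ _ _ 
          "\<lambda>i. Inl (if i = 0 then q else if i = 1 then p else n)"])
      (use mul_fsym in \<open>auto simp: formulas_def mult_A\<close>)
  ultimately have "pdef L M ({v. v n \<in> K} \<inter> {v. v q = v p \<otimes>\<^bsub>A\<^esub> v n})" by (rule pdef_Int)
  then have "pdef L M {v. \<exists>a. v(n := a) \<in> {v. v n \<in> K} \<inter> {v. v q = v p \<otimes>\<^bsub>A\<^esub> v n}}" by (rule pdef_ex)
  moreover have "{v. \<exists>a. v(n := a) \<in> {v. v n \<in> K} \<inter> {v. v q = v p \<otimes>\<^bsub>A\<^esub> v n}} = {v. v q \<in> v p <#\<^bsub>A\<^esub> K}"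
    by (auto simp: n_def l_coset_def)
  ultimately show ?thesis by simp
qed

text \<open>The sets \<open>{y. \<exists>p. y (p div d) \<in> x p <# K (p mod d)}\<close> are tested at the tuples \<open>x\<close> which have
  \<open>h (p mod d) n\<close> everywhere except in one position \<open>p\<close>, where they have \<open>h (p mod d) t\<close> with \<open>t < n\<close>.\<close>

lemma vc_density_ge:
  assumes d: "indep_size d" 
  shows "ereal (real (m * d)) \<le> vc_density L M m"
proof -
  obtain K :: "nat \<Rightarrow> 'a set" where K: "\<And>i. i < d \<Longrightarrow> subgroup (K i) A" "\<And>i. i < d \<Longrightarrow> vdef (K i)"
    and ind: "indep_family A (carrier A) K {..<d}"
    using d unfolding indep_size_def by auto
  obtain Z where Z: "subgroup Z A" "virt_sub A (carrier A) Z" "\<And>x y. x \<in> Z \<Longrightarrow> y \<in> Z \<Longrightarrow> x \<otimes>\<^bsub>A\<^esub> y = y \<otimes>\<^bsub>A\<^esub> x"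
    using abelian_finite_index unfolding carrier_A by blast
  obtain h where "\<And>\<sigma> :: nat \<Rightarrow> nat. \<exists>y\<in>carrier A. \<forall>i<d. \<forall>t. y \<in> h i t <#\<^bsub>A\<^esub> K i \<longleftrightarrow> t = \<sigma> i"
    by (rule A.indep_family_array[OF K(1) ind Z]) blast+
  then obtain y where y: "\<And>\<sigma> i t. i < d \<Longrightarrow> y \<sigma> \<in> h i t <#\<^bsub>A\<^esub> K i \<longleftrightarrow> t = \<sigma> i" by metis
  have inj_h: "t = s" if "i < d" "h i t = h i s" for i t s
    using y[OF that(1), of "\<lambda>_. s" t] y[OF that(1), of "\<lambda>_. s" s] that(2) by simp
  define D where "D = m * d"
  have D: "p mod d < d" "p div d < m" if "p < D" for p
    using that less_mult_imp_div_less[of p m d] unfolding D_def by (auto intro!: mod_less_divisor gr0I)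
  \<comment> \<open>The variables below \<open>D\<close> hold x and those from \<open>D\<close> on
    hold y. A position p encodes the coordinate \<open>p div d\<close> and the subgroup
    \<open>p mod d\<close>.\<close>
  define X where "X = (\<Union>p\<in>{..<D}. {v :: nat \<Rightarrow> 'a. v (D + p div d) \<in> v p <#\<^bsub>A\<^esub> K (p mod d)})"
  have "pdef L M X"
    unfolding X_def by (intro pdef_UN finite_lessThan pdef_lcos K) (auto simp: D)
  then obtain k' c \<phi> where k': "D \<le> k'" and \<phi>: "\<phi> \<in> formulas L" "fv \<phi> \<subseteq> {..<k' + m}"
    and sat: "\<And>a b. a \<in> tuples D \<Longrightarrow> b \<in> tuples m \<Longrightarrow> 
      sat M (join k' (\<lambda>i. if i < D then a i else if i < k' then c i else undefined) b) \<phi> \<longleftrightarrow> join D a b \<in> X"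
    by (rule pdef_formula[where k = D and m = m]) blast
  have "n ^ D \<le> shatter_fun (tuples k') (def_family M k' m \<phi>) (D * n)" for n
  proof -
    \<comment> \<open>The default index n is never a value of \<tau>, which maps into
      \<open>{..<n}\<close>. Hence at such a point the condition can hold only at position
      p.\<close>
    define pt where "pt = (\<lambda>p t. \<lambda>q\<in>{..<D}. h (q mod d) (if q = p then t else n))"
    define pt' where "pt' = (\<lambda>(p, t) i. if i < D then pt p t i else if i < k' then c i else undefined)"
    define B where "B = pt' ` ({..<D} \<times> {..<n})"
    \<comment> \<open>Coordinate j realises the path i -> \<tau> (j * d + i), whose argument is the
      position with quotient j and remainder i.\<close>
    define b where "b = (\<lambda>\<tau>. \<lambda>j\<in>{..<m}. y (\<lambda>i. \<tau> (j * d + i)))"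
    define C where "C = (\<lambda>\<tau>. {a \<in> tuples k'. sat M (join k' a (b \<tau>)) \<phi>})"
    have pt: "pt p t \<in> tuples D" for p t by (simp add: pt_def)
    have b: "b \<tau> \<in> tuples m" for \<tau> by (simp add: b_def)
    have "pt' q \<in> tuples k'" for q
      by (rule PiE_I) (use k' in \<open>auto simp: pt'_def split: prod.split\<close>)
    then have B: "B \<subseteq> tuples k'" by (auto simp: B_def)
    have "inj_on pt' ({..<D} \<times> {..<n})"
    proof (rule inj_onI, clarify)
      fix p t p' t' assume *: "p < D" "t < n" "p' < D" "t' < n" "pt' (p, t) = pt' (p', t')"
      from fun_cong[OF *(5), of p] have "h (p mod d) t = h (p mod d) (if p = p' then t' else n)"
        using * by (simp add: pt'_def pt_def)
      then have "t = (if p = p' then t' else n)" using inj_h D(1)[OF *(1)] by blast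
      then show "p = p' \<and> t = t'" using * by (simp split: if_splits)
    qed
    then have card_B: "card B = D * n" by (simp add: B_def card_image card_cartesian_product)
    have finB: "finite B" by (simp add: B_def)
    have mem_C: "pt' (p, t) \<in> C \<tau> \<longleftrightarrow> t = \<tau> p" 
      if p: "p < D" and t: "t < n" and \<tau>: "\<tau> \<in> {..<D} \<rightarrow>\<^sub>E {..<n}" for p t \<tau>
    proof -
      have "pt' (p, t) \<in> C \<tau> \<longleftrightarrow> join D (pt p t) (b \<tau>) \<in> X"
        using B p t sat[OF pt b] by (auto simp: C_def B_def pt'_def)
      also have "\<dots> \<longleftrightarrow> (\<exists>q<D. b \<tau> (q div d) \<in> pt p t q <#\<^bsub>A\<^esub> K (q mod d))"
        by (auto simp: X_def join_def)
      also have "\<dots> \<longleftrightarrow> (\<exists>q<D. (if q = p then t else n) = \<tau> q)"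
        using y D by (auto simp: b_def pt_def)
      also have "\<dots> \<longleftrightarrow> t = \<tau> p"
        using p PiE_mem[OF \<tau>] by (auto split: if_splits)
      finally show ?thesis .
    qed
    \<comment> \<open>The trace contains the point with position p and index t exactly when t =
      \<tau> p, so \<tau> can be read off.\<close>
    have "inj_on (\<lambda>\<tau>. C \<tau> \<inter> B) ({..<D} \<rightarrow>\<^sub>E {..<n})"
    proof (rule inj_onI)
      fix \<tau> \<sigma> assume \<tau>: "\<tau> \<in> {..<D} \<rightarrow>\<^sub>E {..<n}" and \<sigma>: "\<sigma> \<in> {..<D} \<rightarrow>\<^sub>E {..<n}" and eq: "C \<tau> \<inter> B = C \<sigma> \<inter> B"
      show "\<tau> = \<sigma>"
      proof (rule PiE_ext[OF \<tau> \<sigma>])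
        fix p assume p: "p \<in> {..<D}"
        then have "\<tau> p < n" using \<tau> by auto
        then have "pt' (p, \<tau> p) \<in> C \<tau> \<inter> B" using mem_C[OF _ _ \<tau>] p by (auto simp: B_def)
        then show "\<tau> p = \<sigma> p" using eq mem_C[OF _ _ \<sigma>, of p "\<tau> p"] p \<open>\<tau> p < n\<close> by simp
      qed
    qed
    moreover have "(\<lambda>\<tau>. C \<tau> \<inter> B) ` ({..<D} \<rightarrow>\<^sub>E {..<n}) \<subseteq> {C \<inter> B | C. C \<in> def_family M k' m \<phi>}"
      using b by (auto simp: def_family_def C_def)
    moreover have "finite {C \<inter> B | C. C \<in> def_family M k' m \<phi>}"
      by (rule finite_subset[of _ "Pow B"]) (use finB in auto)
    ultimately have "card ({..<D} \<rightarrow>\<^sub>E {..<n}) \<le> card {C \<inter> B | C. C \<in> def_family M k' m \<phi>}"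
      by (rule card_inj_on_le)
    then show ?thesis
      using shatter_fun_ge[OF B finB, of "def_family M k' m \<phi>"] by (simp add: card_B card_PiE)
  qed
  then have "ereal (real D) \<le> vc (tuples k') (def_family M k' m \<phi>)" by (rule vc_ge)
  also have "\<dots> \<le> vc_density L M m"
    unfolding vc_density_def by (rule Sup_upper) (use \<phi> in blast)
  finally show ?thesis by (simp add: D_def)
qed

section \<open>Linear growth of the vc-density\<close>

theorem vc_density_linear:
  assumes "m > 0"
  shows "vc_density L M m = ereal (real m) * vc_density L M 1"
proof (cases "\<exists>d. \<forall>n. indep_size n \<longrightarrow> n \<le> d")
  case True
  have "indep_size 0" by (auto simp: indep_size_def indep_family_def)
  then obtain d where d: "indep_size d" "\<And>n. indep_size n \<Longrightarrow> n \<le> d"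
    using True GreatestI_nat[of indep_size] Greatest_le_nat[of indep_size] by metis
  have "vc_density L M k = ereal (real (k * d))" for k
    using vc_density_le[OF d(2)] vc_density_ge[OF d(1)] by (intro antisym)
  then show ?thesis by simp
next
  case False
  \<comment> \<open>Independent families of arbitrarily large size d exist, and the lower bound k d
    exceeds every real as soon as k is positive.\<close>
  have "vc_density L M k = \<infinity>" if "k > 0" for k
  proof (rule ereal_top)
    fix B :: real
    obtain d where d: "indep_size d" "nat \<lceil>B\<rceil> < d" using False by (meson not_le)
    have "B \<le> real d" using d(2) by linarith
    also have "\<dots> \<le> real (k * d)" using that by (simp add: mult_le_cancel_right1)
    finally have "ereal B \<le> ereal (real (k * d))" by simp
    then show "ereal B \<le> vc_density L M k" using vc_density_ge[OF d(1)] by (rule order_trans)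
  qed
  then show ?thesis using assms by simp
qed

end

theorem corollary3p8:
  fixes L :: "('f, 'r) lang"
    and mul :: 'f
    and G :: "('g, 'f, 'r) struct"
    and MM :: "('a, 'f, 'r) struct"
    and m :: nat
  assumes "infinite (UNIV :: 'g set)"
    and "group_structure L mul G"
    and "is_model MM (Th L G)"
    and "sufficiently_saturated L MM"
    and "one_based_group L mul MM"
    and "dp_rank_structure L MM < \<infinity>"
    and "m > 0"
  shows "vc_density L MM m = ereal (real m) * vc_density L MM 1"
  by (rule one_based.vc_density_linear[OF one_based.intro]) fact+

end
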